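(* Let $n\ge 1$ be an integer and let $A_1,\dots,A_n,B_1,\dots,B_n\in C_p$ for some real $p>0$, such that $\sum_{i,j=1}^n A_i^*B_j=0$. Then, for each choice of the sign $\pm$ (the same sign in all terms of the sum): if $0<p\le 2$, $$2^{p/2-1}n^{p-1}\left(\sum_{i=1}^n\|A_i\|_p^p+\sum_{i=1}^n\|B_i\|_p^p\right)\le \sum_{i,j=1}^n\|A_i\pm B_j\|_p^p;$$ and if $2\le p<\infty$, $$\sum_{i,j=1}^n\|A_i\pm B_j\|_p^p\le 2^{p/2-1}n^{p-1}\left(\sum_{i=1}^n\|A_i\|_p^p+\sum_{i=1}^n\|B_i\|_p^p\right).$$
   Context: $\mathcal{H}$ is a separable complex Hilbert space and $B(\mathcal{H})$ is the algebra of all bounded linear operators on $\mathcal{H}$. For $A\in B(\mathcal{H})$, $|A|=(A^*A)^{1/2}$. For a compact operator $A\in B(\mathcal{H})$ and $0<p<\infty$, the Schatten $p$-norm (only a quasi-norm when $0<p<1$) is $\|A\|_p=(\operatorname{tr}|A|^p)^{1/p}$, where $\operatorname{tr}$ is the usual trace. The Schatten $p$-class $C_p$ is the set of compact operators $A\in B(\mathcal{H})$ with $\|A\|_p<\infty$; it is a two-sided ideal of $B(\mathcal{H})$. *)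

theory Defs
  imports "HOL-Analysis.Analysis"
begin

text \<open>
  The library has no complex inner product spaces. The real inner product of the underlying
  real space is the real part of the complex one; \<open>cinner\<close> is conjugate-linear in its first
  argument.
\<close>

class complex_inner = real_inner +
  fixes scaleC :: "complex \<Rightarrow> 'a \<Rightarrow> 'a" (infixr "*\<^sub>C" 75)
    and cinner :: "'a \<Rightarrow> 'a \<Rightarrow> complex"
  assumes scaleC_add_right: "c *\<^sub>C (x + y) = c *\<^sub>C x + c *\<^sub>C y"
    and scaleC_add_left: "(c + d) *\<^sub>C x = c *\<^sub>C x + d *\<^sub>C x"
    and scaleC_scaleC: "c *\<^sub>C d *\<^sub>C x = (c * d) *\<^sub>C x"
    and scaleC_of_real: "complex_of_real r *\<^sub>C x = r *\<^sub>R x"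
    and cinner_commute: "cinner x y = cnj (cinner y x)"
    and cinner_add_right: "cinner x (y + z) = cinner x y + cinner x z"
    and cinner_scaleC_right: "cinner x (c *\<^sub>C y) = c * cinner x y"
    and Re_cinner: "Re (cinner x y) = inner x y"

class chilbert_space = complex_inner + complete_space

text \<open>
  The algebra \<open>B(H)\<close>, as the set of complex-linear elements of the library type of bounded
  real-linear operators.
\<close>

definition bounded_ops :: "('a::complex_inner \<Rightarrow>\<^sub>L 'a) set" where
  "bounded_ops = {T :: 'a \<Rightarrow>\<^sub>L 'a. \<forall>c x. T (c *\<^sub>C x) = c *\<^sub>C T x}"

definition compact_operator :: "('a::complex_inner \<Rightarrow>\<^sub>L 'a) \<Rightarrow> bool" where
  "compact_operator T \<longleftrightarrow> T \<in> bounded_ops \<and> compact (closure (T ` cball 0 1))"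

definition positive_operator :: "('a::complex_inner \<Rightarrow>\<^sub>L 'a) \<Rightarrow> bool" where
  "positive_operator T \<longleftrightarrow> T \<in> bounded_ops \<and> (\<forall>x. cinner x (T x) \<in> \<real>\<^sub>\<ge>\<^sub>0)"

definition adj :: "('a::chilbert_space \<Rightarrow>\<^sub>L 'a) \<Rightarrow> ('a \<Rightarrow>\<^sub>L 'a)" where
  "adj T = (THE S. S \<in> bounded_ops \<and> (\<forall>x y. cinner (S x) y = cinner x (T y)))"

definition abs_op :: "('a::chilbert_space \<Rightarrow>\<^sub>L 'a) \<Rightarrow> ('a \<Rightarrow>\<^sub>L 'a)" where
  "abs_op T = (THE P. positive_operator P \<and> P o\<^sub>L P = adj T o\<^sub>L T)"

text \<open>
  The power \<open>T\<^sup>p\<close> (\<open>p > 0\<close>) of a compact positive operator, given by the spectral theorem: if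
  \<open>T = (\<Sum>k. \<lambda>\<^sub>k \<langle>e\<^sub>k, \<cdot>\<rangle> e\<^sub>k)\<close> then \<open>T\<^sup>p = (\<Sum>k. \<lambda>\<^sub>k\<^sup>p \<langle>e\<^sub>k, \<cdot>\<rangle> e\<^sub>k)\<close>. As the eigenvectors of \<open>T\<close>
  span a dense subspace, \<open>T\<^sup>p\<close> is the only bounded operator acting as \<open>\<lambda>\<^sup>p\<close> on the
  eigenspace of every eigenvalue \<open>\<lambda>\<close>, where \<open>0\<^sup>p = 0\<close>.
\<close>

definition powr_op :: "('a::chilbert_space \<Rightarrow>\<^sub>L 'a) \<Rightarrow> real \<Rightarrow> ('a \<Rightarrow>\<^sub>L 'a)" where
  "powr_op T p = (THE S. S \<in> bounded_ops \<and>
     (\<forall>l v. T v = l *\<^sub>R v \<longrightarrow> S v = (l powr p) *\<^sub>R v))"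

definition is_onb :: "'a::chilbert_space set \<Rightarrow> bool" where
  "is_onb E \<longleftrightarrow> (\<forall>e\<in>E. \<forall>f\<in>E. cinner e f = (if e = f then 1 else 0)) \<and>
     (\<forall>x. (\<forall>e\<in>E. cinner e x = 0) \<longrightarrow> x = 0)"

text \<open>
  The trace of a positive operator, with values in \<open>[0,\<infinity>]\<close>; it does not depend on the
  orthonormal basis.
\<close>

definition trace_pos :: "('a::chilbert_space \<Rightarrow>\<^sub>L 'a) \<Rightarrow> ennreal" where
  "trace_pos T = (\<Sum>\<^sub>\<infinity>e\<in>(SOME E. is_onb E). ennreal (Re (cinner e (T e))))"

definition schatten_class :: "real \<Rightarrow> ('a::chilbert_space \<Rightarrow>\<^sub>L 'a) set" where
  "schatten_class p = {T. compact_operator T \<and> trace_pos (powr_op (abs_op T) p) < \<infinity>}"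

text \<open>Meaningful on \<open>schatten_class p\<close> only: an infinite trace would be sent to \<open>0\<close>.\<close>

definition schatten_norm :: "real \<Rightarrow> ('a::chilbert_space \<Rightarrow>\<^sub>L 'a) \<Rightarrow> real" where
  "schatten_norm p T = enn2real (trace_pos (powr_op (abs_op T) p)) powr (1 / p)"

end

theory Submission imports Defs
begin

text \<open>
  Write \<open>q = p / 2\<close>, so that \<open>\<parallel>T\<parallel>\<^sub>p\<^sup>p\<close> is the sum of the \<open>q\<close>-th powers of the eigenvalues of
  \<open>T\<^sup>*T\<close>. Since the cross terms cancel, the operator \<open>Z\<close>, the sum of all \<open>|A\<^sub>i \<plusminus> B\<^sub>j|\<^sup>2\<close>, is also
  the sum of the \<open>2n\<^sup>2\<close> operators \<open>|A\<^sub>i|\<^sup>2\<close>, \<open>|B\<^sub>i|\<^sup>2\<close>, each taken \<open>n\<close> times. For positive compact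
  operators and \<open>q \<ge> 1\<close>,
  \<open>\<Sum>\<^sub>k tr X\<^sub>k\<^sup>q \<le> tr (\<Sum>\<^sub>k X\<^sub>k)\<^sup>q \<le> m\<^sup>q\<^sup>-\<^sup>1 \<Sum>\<^sub>k tr X\<^sub>k\<^sup>q\<close> with \<open>m\<close> the number of summands, and both
  inequalities are reversed for \<open>q \<le> 1\<close>; apply the first to one decomposition of \<open>Z\<close> and the
  second to the other. Both follow from Jensen's inequality for sums over the eigenbases. For
  \<open>q \<le> 1\<close>, exchanging the roles of the decompositions shows that the \<open>\<parallel>A\<^sub>i \<plusminus> B\<^sub>j\<parallel>\<^sub>p\<close> are finite.
\<close>

subsection \<open>Complex inner product spaces and orthonormal bases\<close>

lemma cinner_add_left: "cinner (x + y) z = cinner x z + cinner y (z::'a::complex_inner)"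
  by (metis cinner_add_right cinner_commute complex_cnj_add)

lemma cinner_scaleC_left: "cinner (c *\<^sub>C x) y = cnj c * cinner x (y::'a::complex_inner)"
  by (metis cinner_commute cinner_scaleC_right complex_cnj_mult)

lemma cinner_scaleR_right: "cinner x (r *\<^sub>R y) = of_real r * cinner x (y::'a::complex_inner)"
  by (metis cinner_scaleC_right scaleC_of_real)

lemma cinner_zero_right [simp]: "cinner x (0::'a::complex_inner) = 0"
  using cinner_add_right [of x 0 0] by simp

lemma cinner_minus_right: "cinner x (- y) = - cinner x (y::'a::complex_inner)"
  using cinner_add_right [of x y "- y"] by (simp add: add_eq_0_iff)

lemma cinner_diff_right: "cinner x (y - z) = cinner x y - cinner x (z::'a::complex_inner)"
  using cinner_add_right [of x y "- z"] by (simp add: cinner_minus_right)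

lemma cinner_self: "cinner x x = complex_of_real ((norm (x::'a::complex_inner))\<^sup>2)"
proof (rule complex_eqI)
  show "Im (cinner x x) = Im (complex_of_real ((norm x)\<^sup>2))"
    by (metis Im_complex_of_real Reals_cnj_iff cinner_commute complex_is_Real_iff)
qed (simp add: Re_cinner power2_norm_eq_inner)

lemma cnj_mult_self: "cnj c * c = complex_of_real ((cmod c)\<^sup>2)"
  by (simp add: complex_norm_square mult.commute del: of_real_power)

lemma norm_scaleC: "norm (c *\<^sub>C x) = cmod c * norm (x::'a::complex_inner)"
proof -
  have "cinner (c *\<^sub>C x) (c *\<^sub>C x) = (cnj c * c) * cinner x x"
    by (simp add: cinner_scaleC_left cinner_scaleC_right)
  then have "complex_of_real ((norm (c *\<^sub>C x))\<^sup>2) = complex_of_real ((cmod c * norm x)\<^sup>2)"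
    by (simp add: cinner_self power_mult_distrib cnj_mult_self del: of_real_power)
  then have "(norm (c *\<^sub>C x))\<^sup>2 = (cmod c * norm x)\<^sup>2"
    using of_real_eq_iff by blast
  then show ?thesis
    by (simp add: power2_eq_iff_nonneg)
qed

lemma norm_cinner_le: "cmod (cinner x y) \<le> norm x * norm (y::'a::complex_inner)"
proof (cases "cinner x y = 0")
  case False
  \<comment> \<open>The phase \<open>c\<close> rotates \<open>cinner x y\<close> onto its modulus,
    which is then a real inner product, within reach of the real Cauchy-Schwarz inequality.\<close>
  define c where "c = cnj (cinner x y) / cmod (cinner x y)"
  have "cmod c = 1"
    using False by (simp add: c_def norm_divide)
  have "c * cinner x y = cmod (cinner x y)"
    using False cnj_mult_self [of "cinner x y"] by (simp add: c_def power2_eq_square field_simps)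
  then have "cmod (cinner x y) = inner x (c *\<^sub>C y)"
    by (metis Re_cinner Re_complex_of_real cinner_scaleC_right)
  also have "\<dots> \<le> norm x * norm (c *\<^sub>C y)"
    by (rule norm_cauchy_schwarz)
  finally show ?thesis
    by (simp add: norm_scaleC \<open>cmod c = 1\<close>)
qed simp

lemma scaleC_zero_right [simp]: "c *\<^sub>C (0::'a::complex_inner) = 0"
  using norm_scaleC [of c 0] by simp

lemma scaleC_scaleR: "c *\<^sub>C (r *\<^sub>R x) = r *\<^sub>R (c *\<^sub>C (x::'a::complex_inner))"
  by (metis mult.commute scaleC_of_real scaleC_scaleC)

lemma bounded_linear_cinner_right: "bounded_linear (cinner (x::'a::complex_inner))"
proof (rule bounded_linear_intro)
  show "cmod (cinner x y) \<le> norm y * norm x" for y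
    using norm_cinner_le [of x y] by (simp add: mult.commute)
qed (simp_all add: cinner_add_right cinner_scaleR_right scaleR_conv_of_real)

lemma bounded_linear_cinner_left: "bounded_linear (\<lambda>x. cinner x (y::'a::complex_inner))"
proof -
  have "(\<lambda>x. cinner x y) = (\<lambda>x. cnj (cinner y x))"
    using cinner_commute by blast
  then show ?thesis
    using bounded_linear_compose [OF bounded_linear_cnj bounded_linear_cinner_right] by metis
qed

lemma cinner_sum_right: "cinner x (\<Sum>i\<in>F. f i) = (\<Sum>i\<in>F. cinner x (f i :: 'a::complex_inner))"
  by (metis bounded_linear.linear bounded_linear_cinner_right linear_sum)

lemma cinner_sum_left: "cinner (\<Sum>i\<in>F. f i) x = (\<Sum>i\<in>F. cinner (f i) (x :: 'a::complex_inner))"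
  using linear_sum [OF bounded_linear.linear [OF bounded_linear_cinner_left]] .

lemma bounded_ops_scaleC: "T \<in> bounded_ops \<Longrightarrow> T (c *\<^sub>C x) = c *\<^sub>C T x"
  by (simp add: bounded_ops_def)

section \<open>Orthonormal families and bases\<close>

definition orthonormal :: "'a::complex_inner set \<Rightarrow> bool" where
  "orthonormal E \<longleftrightarrow> (\<forall>e\<in>E. \<forall>f\<in>E. cinner e f = (if e = f then 1 else 0))"

lemma is_onb_iff: "is_onb E \<longleftrightarrow> orthonormal E \<and> (\<forall>x. (\<forall>e\<in>E. cinner e x = 0) \<longrightarrow> x = 0)"
  by (simp add: is_onb_def orthonormal_def)

lemma is_onb_orthonormal: "is_onb E \<Longrightarrow> orthonormal E"
  by (simp add: is_onb_iff)

lemma orthonormalD: "orthonormal E \<Longrightarrow> e \<in> E \<Longrightarrow> f \<in> E \<Longrightarrow> cinner e f = (if e = f then 1 else 0)"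
  by (simp add: orthonormal_def)

lemma orthonormal_norm: "orthonormal E \<Longrightarrow> e \<in> E \<Longrightarrow> norm e = 1"
  using cinner_self [of e] orthonormalD [of E e e]
  by (metis norm_ge_zero of_real_1 of_real_eq_iff power2_eq_1_iff order.trans not_one_le_zero
      neg_0_le_iff_le le_minus_one_simps(3))

lemma orthonormal_cinner_sum:
  assumes "orthonormal E" "finite F" "F \<subseteq> E" "e \<in> E"
  shows "cinner e (\<Sum>f\<in>F. c f *\<^sub>C f) = (if e \<in> F then c e else 0)"
proof -
  have "cinner e (\<Sum>f\<in>F. c f *\<^sub>C f) = (\<Sum>f\<in>F. if e = f then c f else 0)"
    unfolding cinner_sum_right
    by (rule sum.cong) (use assms in \<open>auto simp: cinner_scaleC_right orthonormalD subset_iff\<close>)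
  then show ?thesis
    by (simp add: assms sum.delta)
qed

lemma orthonormal_norm_sum:
  assumes "orthonormal E" "finite F" "F \<subseteq> E"
  shows "(norm (\<Sum>e\<in>F. c e *\<^sub>C e))\<^sup>2 = (\<Sum>e\<in>F. (cmod (c e))\<^sup>2)"
proof -
  have "complex_of_real ((norm (\<Sum>e\<in>F. c e *\<^sub>C e))\<^sup>2) = (\<Sum>e\<in>F. cnj (c e) * c e)"
    unfolding cinner_self [symmetric]
    by (subst cinner_sum_left, rule sum.cong)
      (use assms in \<open>auto simp: cinner_scaleC_left orthonormal_cinner_sum [OF assms]\<close>)
  also have "\<dots> = complex_of_real (\<Sum>e\<in>F. (cmod (c e))\<^sup>2)"
    by (simp add: cnj_mult_self del: of_real_power)
  finally show ?thesis
    using of_real_eq_iff by blast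
qed

text \<open>The net of finite partial sums is Cauchy: once a finite \<open>X\<close> brings the sum
  of squares within \<open>(d/2)\<^sup>2\<close> of its supremum, enlarging \<open>X\<close> moves
  the vector by less than \<open>d/2\<close>. As \<open>E\<close> may be uncountable, finite subsets
  replace sequences.\<close>

lemma riesz_fischer_summable:
  fixes E :: "'a::chilbert_space set"
  assumes E: "orthonormal E" and bd: "\<And>F. finite F \<Longrightarrow> F \<subseteq> E \<Longrightarrow> (\<Sum>e\<in>F. (cmod (c e))\<^sup>2) \<le> K"
  shows "(\<lambda>e. c e *\<^sub>C e) summable_on E"
proof -
  define s where "s = (\<lambda>F. \<Sum>e\<in>F. (cmod (c e))\<^sup>2)"
  define S where "S = (SUP F\<in>{F. finite F \<and> F \<subseteq> E}. s F)"
  have bdd: "bdd_above (s ` {F. finite F \<and> F \<subseteq> E})"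
    using bd by (auto simp: s_def bdd_above_def)
  have "\<exists>P. eventually P (finite_subsets_at_top E) \<and>
      (\<forall>F F'. P F \<and> P F' \<longrightarrow> dist (\<Sum>e\<in>F. c e *\<^sub>C e) (\<Sum>e\<in>F'. c e *\<^sub>C e) < d)" if "d > 0" for d
  proof -
    have "\<exists>X\<in>{F. finite F \<and> F \<subseteq> E}. S - (d/2)\<^sup>2 < s X"
      using bdd \<open>d > 0\<close> by (subst less_cSUP_iff [symmetric]) (auto simp: S_def)
    then obtain X where X: "finite X" "X \<subseteq> E" "S - (d/2)\<^sup>2 < s X"
      by blast
    have near: "dist (\<Sum>e\<in>F. c e *\<^sub>C e) (\<Sum>e\<in>X. c e *\<^sub>C e) < d/2"
      if F: "finite F" "X \<subseteq> F" "F \<subseteq> E" for F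
    proof -
      have "(\<Sum>e\<in>F. c e *\<^sub>C e) - (\<Sum>e\<in>X. c e *\<^sub>C e) = (\<Sum>e\<in>F-X. c e *\<^sub>C e)"
        using F by (simp add: sum_diff)
      moreover have "(norm (\<Sum>e\<in>F-X. c e *\<^sub>C e))\<^sup>2 = s (F - X)"
        unfolding s_def using F by (intro orthonormal_norm_sum [OF E]) auto
      moreover have "s (F - X) = s F - s X"
        unfolding s_def using F by (intro sum_diff) auto
      ultimately have "(dist (\<Sum>e\<in>F. c e *\<^sub>C e) (\<Sum>e\<in>X. c e *\<^sub>C e))\<^sup>2 = s F - s X"
        by (metis dist_norm)
      also have "\<dots> < (d/2)\<^sup>2"
      proof -
        have "s F \<le> S"
          unfolding S_def using F by (intro cSUP_upper [OF _ bdd]) auto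
        then show ?thesis using X by linarith
      qed
      finally show ?thesis
        using \<open>d > 0\<close> by (auto dest: power_less_imp_less_base)
    qed
    show ?thesis
    proof (intro exI conjI allI impI)
      show "\<forall>\<^sub>F F in finite_subsets_at_top E. finite F \<and> X \<subseteq> F \<and> F \<subseteq> E"
        using X by (auto simp: eventually_finite_subsets_at_top)
      show "dist (\<Sum>e\<in>F. c e *\<^sub>C e) (\<Sum>e\<in>F'. c e *\<^sub>C e) < d"
        if "(finite F \<and> X \<subseteq> F \<and> F \<subseteq> E) \<and> (finite F' \<and> X \<subseteq> F' \<and> F' \<subseteq> E)" for F F'
        using near [of F] near [of F'] that
          dist_triangle_half_l [of "\<Sum>e\<in>F. c e *\<^sub>C e" "\<Sum>e\<in>X. c e *\<^sub>C e" d "\<Sum>e\<in>F'. c e *\<^sub>C e"]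
        by blast
    qed
  qed
  then have "cauchy_filter (filtermap (sum (\<lambda>e. c e *\<^sub>C e)) (finite_subsets_at_top E))"
    by (simp add: cauchy_filter_metric_filtermap)
  moreover have "complete (UNIV::'a set)"
    by (meson Cauchy_convergent UNIV_I complete_def convergent_def)
  ultimately obtain l where "((sum (\<lambda>e. c e *\<^sub>C e)) \<longlongrightarrow> l) (finite_subsets_at_top E)"
    using complete_uniform[where S="UNIV::'a set"] by (force simp add: filterlim_def)
  then show ?thesis
    using summable_on_def has_sum_def by blast
qed

lemma has_sum_cinner_basis:
  assumes "orthonormal E" "((\<lambda>e. c e *\<^sub>C e) has_sum v) E" "e \<in> E"
  shows "cinner e v = c e"
proof -
  have "((\<lambda>f. cinner e (c f *\<^sub>C f)) has_sum cinner e v) E"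
    using has_sum_bounded_linear [OF bounded_linear_cinner_right assms(2)] .
  moreover have "((\<lambda>f. cinner e (c f *\<^sub>C f)) has_sum c e) E"
    by (rule has_sum_finite_neutralI [of "{e}"])
      (use assms in \<open>auto simp: cinner_scaleC_right orthonormalD\<close>)
  ultimately show ?thesis
    using has_sum_unique by blast
qed

lemma riesz_fischer:
  fixes E :: "'a::chilbert_space set"
  assumes E: "orthonormal E" and bd: "\<And>F. finite F \<Longrightarrow> F \<subseteq> E \<Longrightarrow> (\<Sum>e\<in>F. (cmod (c e))\<^sup>2) \<le> K"
  shows "\<exists>v. \<forall>e\<in>E. cinner e v = c e"
proof -
  have "((\<lambda>e. c e *\<^sub>C e) has_sum (\<Sum>\<^sub>\<infinity>e\<in>E. c e *\<^sub>C e)) E"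
    using riesz_fischer_summable [OF assms] by simp
  then show ?thesis
    using has_sum_cinner_basis [OF E] by blast
qed

text \<open>With \<open>u\<close> the orthogonal projection of \<open>x\<close> onto the span of
  \<open>F\<close>, \<open>cinner u x\<close> equals the squared norm of \<open>u\<close>, so
  Cauchy-Schwarz gives \<open>norm u \<le> norm x\<close>.\<close>

lemma bessel:
  assumes E: "orthonormal E" and F: "finite F" "F \<subseteq> E"
  shows "(\<Sum>e\<in>F. (cmod (cinner e x))\<^sup>2) \<le> (norm x)\<^sup>2"
proof -
  define u where "u = (\<Sum>e\<in>F. cinner e x *\<^sub>C e)"
  define s where "s = (\<Sum>e\<in>F. (cmod (cinner e x))\<^sup>2)"
  have "cinner u x = complex_of_real s"
    unfolding u_def s_def cinner_sum_left of_real_sum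
    by (rule sum.cong) (auto simp: cinner_scaleC_left cnj_mult_self simp del: of_real_power)
  then have "\<bar>s\<bar> \<le> norm u * norm x"
    using norm_cinner_le [of u x] by simp
  moreover have "(norm u)\<^sup>2 = s"
    unfolding u_def s_def by (rule orthonormal_norm_sum [OF assms])
  moreover from this have "0 \<le> s"
    by (metis zero_le_power2)
  ultimately have "norm u * norm u \<le> norm u * norm x"
    by (simp add: power2_eq_square)
  then have "norm u \<le> norm x"
    by (cases "norm u = 0") (auto simp: mult_le_cancel_left)
  then show ?thesis
    using \<open>(norm u)\<^sup>2 = s\<close> unfolding s_def by (metis norm_ge_zero power_mono)
qed

lemma onb_eqI:
  assumes "is_onb E" "\<And>e. e \<in> E \<Longrightarrow> cinner e x = cinner e y"
  shows "x = y"
proof -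
  have "\<forall>e\<in>E. cinner e (x - y) = 0"
    using assms by (simp add: cinner_diff_right)
  then show ?thesis
    using assms(1) unfolding is_onb_iff by (metis right_minus_eq)
qed

text \<open>Bessel and Riesz-Fischer make the series converge; its sum has the same coefficients as
  \<open>x\<close>, and \<open>E\<close> is total.\<close>

lemma onb_expansion:
  assumes "is_onb E"
  shows "((\<lambda>e. cinner e x *\<^sub>C e) has_sum x) E"
proof -
  have E: "orthonormal E"
    using assms by (rule is_onb_orthonormal)
  have "(\<lambda>e. cinner e x *\<^sub>C e) summable_on E"
    using E bessel [OF E] by (rule riesz_fischer_summable)
  then obtain v where v: "((\<lambda>e. cinner e x *\<^sub>C e) has_sum v) E"
    using summable_iff_has_sum_infsum by blast
  then have "v = x"
    using has_sum_cinner_basis [OF E v] by (intro onb_eqI [OF assms]) auto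
  with v show ?thesis by simp
qed

text \<open>The maps are only real-linear, so agreement is required on all complex multiples of
  basis vectors.\<close>

lemma onb_bounded_linear_eqI:
  fixes f g :: "'a::chilbert_space \<Rightarrow> 'b::real_normed_vector"
  assumes "is_onb E" "bounded_linear f" "bounded_linear g"
    and "\<And>c e. e \<in> E \<Longrightarrow> f (c *\<^sub>C e) = g (c *\<^sub>C e)"
  shows "f x = g x"
proof -
  have "((\<lambda>e. f (cinner e x *\<^sub>C e)) has_sum f x) E"
    by (rule has_sum_bounded_linear [OF assms(2) onb_expansion [OF assms(1)]])
  moreover have "f (cinner e x *\<^sub>C e) = g (cinner e x *\<^sub>C e)" if "e \<in> E" for e
    using that by (rule assms(4))
  ultimately have "((\<lambda>e. g (cinner e x *\<^sub>C e)) has_sum f x) E"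
    using has_sum_cong [of E "\<lambda>e. f (cinner e x *\<^sub>C e)" "\<lambda>e. g (cinner e x *\<^sub>C e)"] by blast
  moreover have "((\<lambda>e. g (cinner e x *\<^sub>C e)) has_sum g x) E"
    by (rule has_sum_bounded_linear [OF assms(3) onb_expansion [OF assms(1)]])
  ultimately show ?thesis
    by (rule has_sum_unique)
qed

lemma parseval:
  assumes "is_onb E"
  shows "((\<lambda>e. (cmod (cinner e x))\<^sup>2) has_sum (norm x)\<^sup>2) E"
proof -
  have "((\<lambda>e. Re (cinner x (cinner e x *\<^sub>C e))) has_sum Re (cinner x x)) E"
    by (intro has_sum_Re has_sum_bounded_linear [OF bounded_linear_cinner_right] onb_expansion assms)
  moreover have "Re (cinner x (cinner e x *\<^sub>C e)) = (cmod (cinner e x))\<^sup>2" for e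
  proof -
    have "cinner x (cinner e x *\<^sub>C e) = complex_of_real ((cmod (cinner e x))\<^sup>2)"
      using complex_norm_square [of "cinner e x"] cinner_commute [of x e]
      by (simp add: cinner_scaleC_right)
    then show ?thesis by (metis Re_complex_of_real)
  qed
  ultimately show ?thesis
    by (simp add: cinner_self)
qed

lemma cmod_cinner_commute: "cmod (cinner x y) = cmod (cinner y x)"
  by (metis cinner_commute complex_mod_cnj)

text \<open>The source of adjoints and of diagonal operators: prescribe the coefficients of
  \<open>S x\<close> in \<open>E\<close>. The one square-sum bound provides both the vector
  \<open>S x\<close>, by Riesz-Fischer, and the operator bound \<open>K\<close>, by
  Parseval.\<close>

lemma bounded_op_of_coefficients:
  fixes c :: "'a::chilbert_space \<Rightarrow> 'a \<Rightarrow> complex"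
  assumes E: "is_onb E"
    and add: "\<And>e x y. e \<in> E \<Longrightarrow> c e (x + y) = c e x + c e y"
    and scale: "\<And>e a x. e \<in> E \<Longrightarrow> c e (a *\<^sub>C x) = a * c e x"
    and bd: "\<And>F x. finite F \<Longrightarrow> F \<subseteq> E \<Longrightarrow> (\<Sum>e\<in>F. (cmod (c e x))\<^sup>2) \<le> (K * norm x)\<^sup>2"
    and K: "K \<ge> 0"
  shows "\<exists>S\<in>bounded_ops. \<forall>x. \<forall>e\<in>E. cinner e (S x) = c e x"
proof -
  have "\<forall>x. \<exists>v. \<forall>e\<in>E. cinner e v = c e x"
    using riesz_fischer [OF is_onb_orthonormal [OF E] bd] by blast
  then obtain s where s: "\<And>x e. e \<in> E \<Longrightarrow> cinner e (s x) = c e x"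
    by metis
  have sC: "s (a *\<^sub>C x) = a *\<^sub>C s x" for a x
    by (rule onb_eqI [OF E]) (simp add: s scale cinner_scaleC_right)
  have "bounded_linear s"
  proof (rule bounded_linear_intro)
    show "s (x + y) = s x + s y" for x y
      by (rule onb_eqI [OF E]) (simp add: s add cinner_add_right)
    show "s (r *\<^sub>R x) = r *\<^sub>R s x" for r x
      using sC [of "of_real r" x] by (simp add: scaleC_of_real)
    show "norm (s x) \<le> norm x * K" for x
    proof -
      have "(norm (s x))\<^sup>2 \<le> (K * norm x)\<^sup>2"
        using has_sum_le_finite_sums [OF parseval [OF E, of "s x"]] bd [of _ x] s
        by (smt (verit, best) subsetD sum.cong)
      then show ?thesis
        using K by (simp add: abs_le_square_iff [symmetric] mult.commute)
    qed
  qed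
  then have "blinfun_apply (Blinfun s) = s"
    by (rule bounded_linear_Blinfun_apply)
  then show ?thesis
    by (intro bexI [of _ "Blinfun s"]) (auto simp: s sC bounded_ops_def)
qed

subsection \<open>Sums in the extended nonnegative reals\<close>

lemma infsum_mono_ennreal:
  fixes f g :: "'i \<Rightarrow> ennreal"
  shows "(\<And>x. x \<in> A \<Longrightarrow> f x \<le> g x) \<Longrightarrow> infsum f A \<le> infsum g A"
  by (rule infsum_mono) (auto intro: nonneg_summable_on_complete)

lemma infsum_sum_ennreal:
  fixes f :: "'k \<Rightarrow> 'i \<Rightarrow> ennreal"
  assumes "finite I"
  shows "(\<Sum>\<^sub>\<infinity>x\<in>A. \<Sum>k\<in>I. f k x) = (\<Sum>k\<in>I. \<Sum>\<^sub>\<infinity>x\<in>A. f k x)"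
  using assms by induction (simp_all add: infsum_add nonneg_summable_on_complete)

text \<open>Half of Tonelli for index sets of any cardinality. A finite part of the outer sum passes
  through the inner one by additivity; the other half is this one with \<open>A\<close> and
  \<open>B\<close> exchanged.\<close>

lemma infsum_swap_ennreal_le:
  fixes f :: "'i \<Rightarrow> 'j \<Rightarrow> ennreal"
  shows "(\<Sum>\<^sub>\<infinity>x\<in>A. \<Sum>\<^sub>\<infinity>y\<in>B. f x y) \<le> (\<Sum>\<^sub>\<infinity>y\<in>B. \<Sum>\<^sub>\<infinity>x\<in>A. f x y)"
proof (rule infsum_le_finite_sums)
  fix F assume F: "finite F" "F \<subseteq> A"
  have "(\<Sum>x\<in>F. \<Sum>\<^sub>\<infinity>y\<in>B. f x y) = (\<Sum>\<^sub>\<infinity>y\<in>B. \<Sum>x\<in>F. f x y)"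
    using F by (simp add: infsum_sum_ennreal)
  also have "\<dots> \<le> (\<Sum>\<^sub>\<infinity>y\<in>B. \<Sum>\<^sub>\<infinity>x\<in>A. f x y)"
    using F by (intro infsum_mono_ennreal)
      (auto simp: nonneg_infsum_complete [where A=A] intro!: SUP_upper)
  finally show "(\<Sum>x\<in>F. \<Sum>\<^sub>\<infinity>y\<in>B. f x y) \<le> (\<Sum>\<^sub>\<infinity>y\<in>B. \<Sum>\<^sub>\<infinity>x\<in>A. f x y)" .
qed (simp add: nonneg_summable_on_complete)

lemma infsum_swap_ennreal:
  fixes f :: "'i \<Rightarrow> 'j \<Rightarrow> ennreal"
  shows "(\<Sum>\<^sub>\<infinity>x\<in>A. \<Sum>\<^sub>\<infinity>y\<in>B. f x y) = (\<Sum>\<^sub>\<infinity>y\<in>B. \<Sum>\<^sub>\<infinity>x\<in>A. f x y)"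
  by (intro antisym infsum_swap_ennreal_le)

lemma infsum_cmult_ennreal:
  fixes f :: "'i \<Rightarrow> ennreal"
  shows "(\<Sum>\<^sub>\<infinity>x\<in>A. c * f x) = c * (\<Sum>\<^sub>\<infinity>x\<in>A. f x)"
proof -
  have "(\<Sum>\<^sub>\<infinity>x\<in>A. c * f x) = (SUP F\<in>{F. finite F \<and> F\<subseteq>A}. c * sum f F)"
    by (simp add: nonneg_infsum_complete sum_distrib_left)
  also have "\<dots> = c * (SUP F\<in>{F. finite F \<and> F\<subseteq>A}. sum f F)"
    by (rule SUP_mult_left_ennreal [symmetric])
  finally show ?thesis
    by (simp add: nonneg_infsum_complete)
qed

lemma has_sum_infsum_ennreal:
  fixes f :: "'i \<Rightarrow> real"
  assumes "(f has_sum s) A" "\<And>x. x \<in> A \<Longrightarrow> f x \<ge> 0"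
  shows "(\<Sum>\<^sub>\<infinity>x\<in>A. ennreal (f x)) = ennreal s"
proof -
  have "(\<Sum>\<^sub>\<infinity>x\<in>A. ennreal (f x)) = (SUP F\<in>{F. finite F \<and> F\<subseteq>A}. ennreal (sum f F))"
    unfolding nonneg_infsum_complete [OF zero_le]
    using assms(2) by (intro SUP_cong refl sum_ennreal) auto
  also have "\<dots> = ennreal (infsum f A)"
    using assms by (intro infsum_nonneg_is_SUPREMUM_ennreal [symmetric]) (auto simp: summable_on_def)
  finally show ?thesis
    using assms(1) by (simp add: infsumI)
qed

subsection \<open>Eigenbases of compact positive operators\<close>

lemma positive_operator_inner:
  assumes "positive_operator T"
  shows "0 \<le> inner x (T x)" "cinner x (T x) = complex_of_real (inner x (T x))"
proof -
  have "cinner x (T x) \<in> \<real>\<^sub>\<ge>\<^sub>0"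
    using assms by (simp add: positive_operator_def)
  then show "0 \<le> inner x (T x)" "cinner x (T x) = complex_of_real (inner x (T x))"
    by (auto elim!: nonneg_Reals_cases simp flip: Re_cinner)
qed

text \<open>By polarization of the real-valued form \<open>\<langle>x, T x\<rangle>\<close>.\<close>

lemma positive_operator_symmetric:
  assumes "positive_operator T"
  shows "cinner (T x) y = cinner x (T y)"
proof -
  have T: "T \<in> bounded_ops"
    using assms by (simp add: positive_operator_def)
  have im: "Im (cinner x (T x)) = 0" for x
    using positive_operator_inner(2) [OF assms, of x] by simp
  have "Im (cinner x (T y)) + Im (cinner y (T x)) = 0"
    using im [of "x + y"] im [of x] im [of y]
    by (simp add: cinner_add_left cinner_add_right blinfun.add_right)
  moreover have "Re (cinner x (T y)) - Re (cinner y (T x)) = 0"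
    using im [of "x + \<i> *\<^sub>C y"] im [of x] im [of y]
    by (simp add: cinner_add_left cinner_add_right blinfun.add_right bounded_ops_scaleC [OF T]
        cinner_scaleC_left cinner_scaleC_right)
  ultimately have "cnj (cinner y (T x)) = cinner x (T y)"
    by (intro complex_eqI) auto
  then show ?thesis
    by (metis cinner_commute)
qed

lemma symmetric_inner_square:
  assumes "positive_operator T"
  shows "inner x (T (T x)) = (norm (T x))\<^sup>2"
  by (metis Re_cinner positive_operator_symmetric [OF assms] power2_norm_eq_inner)

text \<open>The defect \<open>y\<close> satisfies \<open>T y = - r y\<close>, which positivity
  allows for \<open>r > 0\<close> only if \<open>y = 0\<close>. For \<open>r = 0\<close> the squared
  norm of \<open>T x\<close> is \<open>inner x (T (T x)) = 0\<close>. This serves to extract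
  eigenvectors of \<open>T\<close> from those of its square and to show that positive square roots
  are unique.\<close>

lemma positive_operator_square_eigen:
  assumes T: "positive_operator T" and "T (T x) = r\<^sup>2 *\<^sub>R x" "r \<ge> 0"
  shows "T x = r *\<^sub>R x"
proof (cases "r = 0")
  case True
  then have "(norm (T x))\<^sup>2 = 0"
    using symmetric_inner_square [OF T, of x] assms by simp
  then show ?thesis using True by simp
next
  case False
  define y where "y = T x - r *\<^sub>R x"
  have "T y = - r *\<^sub>R y"
    using assms(2) by (simp add: y_def blinfun.diff_right blinfun.scaleR_right algebra_simps power2_eq_square)
  then have "0 \<le> - (r * (norm y)\<^sup>2)"
    using positive_operator_inner(1) [OF T, of y] by (simp add: power2_norm_eq_inner)
  moreover have "0 \<le> r * (norm y)\<^sup>2"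
    using assms by simp
  ultimately have "y = 0"
    using False by auto
  then show ?thesis by (simp add: y_def)
qed

lemma norm_diff_scaleR_square:
  fixes a w :: "'a::real_inner"
  shows "(norm (a - c *\<^sub>R w))\<^sup>2 = (norm a)\<^sup>2 - 2 * c * inner w a + c\<^sup>2 * (norm w)\<^sup>2"
  unfolding power2_norm_eq_inner inner_diff_left inner_diff_right
  by (simp add: inner_commute [of a w] power2_eq_square)

text \<open>Maximize \<open>norm (T u)\<close> over the unit vectors of \<open>V\<close>, with
  supremum \<open>m\<close>. If \<open>m > 0\<close>, then \<open>T (T u) - m\<^sup>2 u\<close>
  tends to 0 along a maximizing sequence, and compactness of \<open>T\<close> turns this into
  convergence of a subsequence of the \<open>u\<close> themselves.\<close>

lemma compact_positive_eigenvector: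
  fixes T :: "'a::complex_inner \<Rightarrow>\<^sub>L 'a"
  assumes T: "positive_operator T" "compact_operator T"
    and V: "closed V" "\<And>x. x \<in> V \<Longrightarrow> T x \<in> V" "\<And>r x. x \<in> V \<Longrightarrow> r *\<^sub>R x \<in> V"
    and x0: "x0 \<in> V" "x0 \<noteq> 0"
  shows "\<exists>u\<in>V. norm u = 1 \<and> (\<exists>l. T u = l *\<^sub>R u)"
proof -
  define U where "U = {u \<in> V. norm u = 1}"
  define m where "m = (SUP u\<in>U. norm (T u))"
  have u0: "x0 /\<^sub>R norm x0 \<in> U"
    using V(3) x0 by (simp add: U_def)
  have bdd: "bdd_above ((\<lambda>u. norm (T u)) ` U)"
    using norm_blinfun [of T] by (auto simp: U_def bdd_above_def intro!: exI [of _ "norm T"])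
      (metis mult.right_neutral)
  have le_m: "norm (T u) \<le> m" if "u \<in> U" for u
    unfolding m_def by (rule cSUP_upper [OF that bdd])
  then have "0 \<le> m"
    using u0 norm_ge_zero order.trans by blast
  show ?thesis
  proof (cases "m = 0")
    case True
    then have "T (x0 /\<^sub>R norm x0) = 0 *\<^sub>R (x0 /\<^sub>R norm x0)"
      using le_m [OF u0] by simp
    then show ?thesis
      using u0 unfolding U_def by blast
  next
    case False
    with \<open>0 \<le> m\<close> have "m > 0" by simp
    have le_m': "norm (T x) \<le> m * norm x" if "x \<in> V" for x
    proof (cases "x = 0")
      case False
      then have "x /\<^sub>R norm x \<in> U"
        using V(3) that by (simp add: U_def)
      from le_m [OF this] show ?thesis
        using False by (simp add: blinfun.scaleR_right field_simps)
    qed simp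
    have "\<exists>u\<in>U. m - 1 / real (Suc n) < norm (T u)" for n
    proof -
      have "U \<noteq> {}" "m - 1 / real (Suc n) < m"
        using u0 by auto
      then show ?thesis
        using less_cSUP_iff [OF _ bdd, of "m - 1 / real (Suc n)"] by (simp add: m_def)
    qed
    then obtain u where u: "\<And>n. u n \<in> U" "\<And>n. m - 1 / real (Suc n) < norm (T (u n))"
      by metis
    have lim_norm: "(\<lambda>n. norm (T (u n))) \<longlonglongrightarrow> m"
    proof (rule tendsto_sandwich [where h = "\<lambda>_. m"])
      show "(\<lambda>n. m - 1 / real (Suc n)) \<longlonglongrightarrow> m"
        using tendsto_diff [OF tendsto_const LIMSEQ_Suc [OF lim_1_over_n]] by simp
    qed (use u le_m in \<open>auto intro!: always_eventually simp: less_imp_le\<close>)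
    have "compact (closure (T ` cball 0 1))"
      using T(2) by (simp add: compact_operator_def)
    moreover have "T (u n) \<in> closure (T ` cball 0 1)" for n
      using u(1) [of n] by (intro subsetD [OF closure_subset] imageI) (simp add: U_def)
    ultimately obtain v r where r: "strict_mono (r :: nat \<Rightarrow> nat)" "((\<lambda>n. T (u n)) \<circ> r) \<longlonglongrightarrow> v"
      unfolding compact_def by meson
    define d where "d = (\<lambda>n. T (T (u (r n))) - m\<^sup>2 *\<^sub>R u (r n))"
    \<comment> \<open>Expand the square: the cross term is governed by
      \<open>inner u (T (T u)) = (norm (T u))\<^sup>2\<close>, and
      \<open>norm (T (T u)) \<le> m\<^sup>2\<close> because \<open>T u\<close> stays in
      \<open>V\<close>.\<close>
    have d_le: "(norm (d n))\<^sup>2 \<le> 2 * m\<^sup>2 * (m\<^sup>2 - (norm (T (u (r n))))\<^sup>2)" for n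
    proof -
      have w: "norm (u (r n)) = 1" "u (r n) \<in> V"
        using u(1) by (auto simp: U_def)
      have "norm (T (T (u (r n)))) \<le> m * (m * norm (u (r n)))"
        using le_m' [OF V(2) [OF w(2)]] le_m' [OF w(2)] \<open>m > 0\<close>
        by (meson less_imp_le mult_left_mono order.trans)
      then have "(norm (T (T (u (r n)))))\<^sup>2 \<le> (m * m)\<^sup>2"
        using w(1) by (intro power_mono) auto
      moreover have "(norm (d n))\<^sup>2 = (norm (T (T (u (r n)))))\<^sup>2 - 2 * m\<^sup>2 * (norm (T (u (r n))))\<^sup>2 + m^4"
        using w(1) symmetric_inner_square [OF T(1), of "u (r n)"]
          norm_diff_scaleR_square [of "T (T (u (r n)))" "m\<^sup>2" "u (r n)"]
        by (simp add: d_def flip: power_mult)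
      ultimately show ?thesis
        by (simp add: right_diff_distrib power2_eq_square power4_eq_xxxx)
    qed
    have lim_r: "(\<lambda>n. norm (T (u (r n)))) \<longlonglongrightarrow> m"
      using LIMSEQ_subseq_LIMSEQ [OF lim_norm r(1)] by (simp add: o_def)
    have "(\<lambda>n. 2 * m\<^sup>2 * (m\<^sup>2 - (norm (T (u (r n))))\<^sup>2)) \<longlonglongrightarrow> 2 * m\<^sup>2 * (m\<^sup>2 - m\<^sup>2)"
      by (intro tendsto_intros lim_r)
    then have upper: "(\<lambda>n. 2 * m\<^sup>2 * (m\<^sup>2 - (norm (T (u (r n))))\<^sup>2)) \<longlonglongrightarrow> 0"
      by simp
    have "(\<lambda>n. (norm (d n))\<^sup>2) \<longlonglongrightarrow> 0"
      by (rule tendsto_sandwich [OF _ _ tendsto_const upper]) (simp_all add: d_le)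
    then have "(\<lambda>n. norm (d n)) \<longlonglongrightarrow> 0"
      using tendsto_real_sqrt [of "\<lambda>n. (norm (d n))\<^sup>2" 0] by simp
    then have d0: "d \<longlonglongrightarrow> 0"
      by (simp add: tendsto_norm_zero_iff)
    define w where "w = T v /\<^sub>R m\<^sup>2"
    have Tv: "(\<lambda>n. T (T (u (r n)))) \<longlonglongrightarrow> T v"
      using r(2) by (intro tendsto_intros) (simp add: o_def)
    \<comment> \<open>Solving the definition of \<open>d\<close> for \<open>u (r n)\<close>
      transfers the convergence of \<open>T (T (u (r n)))\<close> to the vectors themselves.\<close>
    have u_eq: "u (r n) = (T (T (u (r n))) - d n) /\<^sub>R m\<^sup>2" for n
      using \<open>m > 0\<close> by (simp add: d_def)
    have lim_u: "(\<lambda>n. u (r n)) \<longlonglongrightarrow> w"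
      using tendsto_scaleR [OF tendsto_const tendsto_diff [OF Tv d0], of "inverse (m\<^sup>2)"]
      by (subst u_eq) (simp add: w_def)
    have "w \<in> V"
      using u(1) by (intro closed_sequentially [OF V(1) _ lim_u]) (simp add: U_def)
    moreover have "norm w = 1"
    proof -
      have "norm (u (r n)) = 1" for n
        using u(1) by (simp add: U_def)
      then have "(\<lambda>_::nat. 1) \<longlonglongrightarrow> norm w"
        using tendsto_norm [OF lim_u] by simp
      then show ?thesis
        by (simp add: LIMSEQ_const_iff)
    qed
    \<comment> \<open>The limits give \<open>T w = v\<close> and \<open>T v = m\<^sup>2 w\<close>,
      so \<open>w\<close> is an eigenvector of the square of \<open>T\<close>; positivity extracts
      the root.\<close>
    moreover have "T w = m *\<^sub>R w"
    proof -
      have "(\<lambda>n. T (u (r n))) \<longlonglongrightarrow> T w"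
        by (intro tendsto_intros lim_u)
      then have "v = T w"
        using r(2) LIMSEQ_unique by (auto simp: o_def)
      moreover have "T v = m\<^sup>2 *\<^sub>R w"
        using \<open>m > 0\<close> by (simp add: w_def)
      ultimately have "T (T w) = m\<^sup>2 *\<^sub>R w"
        by simp
      from positive_operator_square_eigen [OF T(1) this] \<open>m > 0\<close> show ?thesis
        by simp
    qed
    ultimately show ?thesis by blast
  qed
qed

text \<open>The eigenvalue of a basis vector \<open>e\<close> is not named; it is recovered below as
  \<open>inner e (T e)\<close>.\<close>

definition eigen_onb :: "('a::chilbert_space \<Rightarrow>\<^sub>L 'a) \<Rightarrow> 'a set \<Rightarrow> bool" where
  "eigen_onb T E \<longleftrightarrow> is_onb E \<and> (\<forall>e\<in>E. \<exists>l. T e = l *\<^sub>R e)"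

text \<open>By Zorn there is a maximal orthonormal set \<open>M\<close> of eigenvectors. Its
  orthogonal complement is closed and, by symmetry of \<open>T\<close>, invariant; if it were
  nonzero it would contain a further unit eigenvector.\<close>

lemma compact_positive_eigen_onb:
  assumes T: "positive_operator T" "compact_operator T"
  shows "\<exists>E. eigen_onb T E"
proof -
  define \<A> where "\<A> = {E. orthonormal E \<and> (\<forall>e\<in>E. \<exists>l. T e = l *\<^sub>R e)}"
  have "\<Union>\<C> \<in> \<A>" if "subset.chain \<A> \<C>" for \<C>
  proof -
    have sub: "\<C> \<subseteq> \<A>" and ch: "\<And>X Y. X \<in> \<C> \<Longrightarrow> Y \<in> \<C> \<Longrightarrow> X \<subseteq> Y \<or> Y \<subseteq> X"
      using that by (auto simp: subset_chain_def)
    have "orthonormal (\<Union>\<C>)"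
      unfolding orthonormal_def
    proof (intro ballI)
      fix e f assume "e \<in> \<Union>\<C>" "f \<in> \<Union>\<C>"
      then obtain X where "X \<in> \<C>" "e \<in> X" "f \<in> X"
        using ch by blast
      then show "cinner e f = (if e = f then 1 else 0)"
        using sub by (intro orthonormalD) (auto simp: \<A>_def)
    qed
    then show ?thesis
      using sub by (auto simp: \<A>_def)
  qed
  then obtain M where M: "M \<in> \<A>" and maxi: "\<And>X. X \<in> \<A> \<Longrightarrow> M \<subseteq> X \<Longrightarrow> X = M"
    using subset_Zorn' [of \<A>] by blast
  have ortho: "orthonormal M" and eig: "\<And>e. e \<in> M \<Longrightarrow> \<exists>l. T e = l *\<^sub>R e"
    using M by (auto simp: \<A>_def)
  have "x = 0" if x: "\<forall>e\<in>M. cinner e x = 0" for x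
  proof (rule ccontr)
    assume "x \<noteq> 0"
    define V where "V = {x. \<forall>e\<in>M. cinner e x = 0}"
    have "closed V"
    proof -
      have "V = (\<Inter>e\<in>M. {x. cinner e x = 0})"
        by (auto simp: V_def)
      moreover have "closed {x. cinner e x = 0}" for e :: 'a
        by (intro closed_Collect_eq continuous_on_const linear_continuous_on
            bounded_linear_cinner_right)
      ultimately show ?thesis
        by auto
    qed
    moreover have "T y \<in> V" if "y \<in> V" for y
      unfolding V_def
    proof (intro CollectI ballI)
      fix e assume "e \<in> M"
      then obtain l where l: "T e = l *\<^sub>R e"
        using eig by blast
      have "cinner e (T y) = cinner (l *\<^sub>R e) y"
        using positive_operator_symmetric [OF T(1), of e y] l by simp
      then show "cinner e (T y) = 0"
        using that \<open>e \<in> M\<close> by (simp add: V_def cinner_scaleC_left flip: scaleC_of_real)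
    qed
    moreover have "r *\<^sub>R y \<in> V" if "y \<in> V" for r y
      using that by (simp add: V_def cinner_scaleR_right)
    moreover have "x \<in> V"
      using x by (simp add: V_def)
    ultimately obtain u l where u: "u \<in> V" "norm u = 1" "T u = l *\<^sub>R u"
      using compact_positive_eigenvector [OF T, of V x] \<open>x \<noteq> 0\<close> by blast
    have "cinner u e = 0" if "e \<in> M" for e
      using u(1) that by (subst cinner_commute) (simp add: V_def)
    then have "insert u M \<in> \<A>"
      using ortho eig u by (auto simp: \<A>_def orthonormal_def V_def cinner_self)
    then have "u \<in> M"
      using maxi by blast
    then show False
      using u(1,2) cinner_self [of u] by (auto simp: V_def)
  qed
  then show ?thesis
    using ortho eig by (auto simp: eigen_onb_def is_onb_iff)
qed

section \<open>Closure properties of compact and positive operators\<close>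

lemma compact_operator_bounded: "compact_operator T \<Longrightarrow> T \<in> bounded_ops"
  by (simp add: compact_operator_def)

lemma compact_operator_subset:
  assumes "T \<in> bounded_ops" "compact K" "T ` cball 0 1 \<subseteq> K"
  shows "compact_operator T"
proof -
  have "closure (T ` cball 0 1) \<subseteq> K"
    using assms by (simp add: closure_minimal compact_imp_closed)
  then show ?thesis
    using assms compact_Int_closed [of K "closure (T ` cball 0 1)"]
    by (simp add: compact_operator_def Int_absorb1)
qed

lemma compact_operator_zero: "compact_operator (0 :: 'a::complex_inner \<Rightarrow>\<^sub>L 'a)"
proof -
  have "blinfun_apply (0 :: 'a \<Rightarrow>\<^sub>L 'a) ` cball 0 1 \<subseteq> {0}"
    by auto
  then show ?thesis
    by (intro compact_operator_subset [where K = "{0}"]) (auto simp: bounded_ops_def)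
qed

lemma compact_operator_compose_left:
  assumes "S \<in> bounded_ops" "compact_operator T"
  shows "compact_operator (S o\<^sub>L T)"
proof (rule compact_operator_subset)
  show "S o\<^sub>L T \<in> bounded_ops"
    using assms by (simp add: compact_operator_def bounded_ops_def)
  show "compact (S ` closure (T ` cball 0 1))"
    using assms(2) by (intro compact_continuous_image blinfun.continuous_on continuous_intros)
      (simp add: compact_operator_def)
  show "(S o\<^sub>L T) ` cball 0 1 \<subseteq> S ` closure (T ` cball 0 1)"
    using closure_subset [of "T ` cball 0 1"] by auto
qed

lemma compact_operator_add:
  assumes "compact_operator S" "compact_operator T"
  shows "compact_operator (S + T)"
proof (rule compact_operator_subset)
  show "S + T \<in> bounded_ops"
    using assms by (simp add: compact_operator_def bounded_ops_def plus_blinfun.rep_eq scaleC_add_right)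
  show "compact {x + y |x y. x \<in> closure (S ` cball 0 1) \<and> y \<in> closure (T ` cball 0 1)}"
    using assms by (intro compact_sums) (auto simp: compact_operator_def)
  show "(S + T) ` cball 0 1 \<subseteq> {x + y |x y. x \<in> closure (S ` cball 0 1) \<and> y \<in> closure (T ` cball 0 1)}"
    using closure_subset [of "S ` cball 0 1"] closure_subset [of "T ` cball 0 1"]
    by (fastforce simp: plus_blinfun.rep_eq)
qed

lemma compact_operator_sum:
  assumes "\<And>i. i \<in> I \<Longrightarrow> compact_operator (T i)"
  shows "compact_operator (\<Sum>i\<in>I. T i)"
  using assms by (induction I rule: infinite_finite_induct)
    (auto simp: compact_operator_zero intro!: compact_operator_add)

lemma compact_operator_uminus:
  assumes "compact_operator T"
  shows "compact_operator (- T)"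
proof (rule compact_operator_subset)
  have "- (c *\<^sub>C x) = c *\<^sub>C (- x)" for c and x :: 'a
    using scaleC_scaleR [of c "-1" x] by simp
  then show "- T \<in> bounded_ops"
    using assms by (simp add: compact_operator_def bounded_ops_def uminus_blinfun.rep_eq)
  show "compact (uminus ` closure (T ` cball 0 1))"
    using assms by (intro compact_negations) (simp add: compact_operator_def)
  show "(- T) ` cball 0 1 \<subseteq> uminus ` closure (T ` cball 0 1)"
    using closure_subset [of "T ` cball 0 1"] by (auto simp: uminus_blinfun.rep_eq)
qed

lemma compact_operator_diff:
  "compact_operator S \<Longrightarrow> compact_operator T \<Longrightarrow> compact_operator (S - T)"
  using compact_operator_add [of S "- T"] compact_operator_uminus [of T] by simp

lemma positive_operator_zero: "positive_operator 0"
  by (simp add: positive_operator_def bounded_ops_def)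

lemma positive_operator_sum:
  assumes "\<And>i. i \<in> I \<Longrightarrow> positive_operator (T i)"
  shows "positive_operator (\<Sum>i\<in>I. T i)"
  using assms
proof (induction I rule: infinite_finite_induct)
  case (insert i I)
  then show ?case
    by (auto simp: positive_operator_def bounded_ops_def plus_blinfun.rep_eq cinner_add_right
        scaleC_add_right)
qed (auto simp: positive_operator_zero)

text \<open>An eigenbasis of the zero operator is just an orthonormal basis.\<close>

lemma onb_exists: "\<exists>E :: 'a::chilbert_space set. is_onb E"
  using compact_positive_eigen_onb [OF positive_operator_zero compact_operator_zero]
  by (auto simp: eigen_onb_def)

subsection \<open>Diagonal operators and the trace\<close>

text \<open>The coefficients of \<open>S x\<close> have to be \<open>cinner (T e) x\<close>. The
  truncation \<open>u\<close> of \<open>S x\<close> to \<open>F\<close> satisfies \<open>(norm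
  u)\<^sup>2 = cinner (T u) x \<le> norm T * norm u * norm x\<close>, and cancelling
  \<open>norm u\<close> gives the required bound.\<close>

lemma adj_exists:
  fixes T :: "'a::chilbert_space \<Rightarrow>\<^sub>L 'a"
  assumes T: "T \<in> bounded_ops"
  shows "\<exists>S\<in>bounded_ops. \<forall>x y. cinner (S x) y = cinner x (T y)"
proof -
  obtain E :: "'a set" where E: "is_onb E"
    using onb_exists by blast
  have "\<exists>S\<in>bounded_ops. \<forall>x. \<forall>e\<in>E. cinner e (S x) = cinner (T e) x"
  proof (rule bounded_op_of_coefficients [OF E])
    fix F x assume F: "finite F" "F \<subseteq> E"
    define c where "c = (\<lambda>e. cinner (T e) x)"
    define u where "u = (\<Sum>e\<in>F. c e *\<^sub>C e)"
    define s where "s = (\<Sum>e\<in>F. (cmod (c e))\<^sup>2)"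
    have u: "(norm u)\<^sup>2 = s"
      unfolding u_def s_def by (rule orthonormal_norm_sum [OF is_onb_orthonormal [OF E] F])
    have "cinner (T u) x = (\<Sum>e\<in>F. cnj (c e) * c e)"
      by (simp add: u_def blinfun.sum_right bounded_ops_scaleC [OF T] cinner_sum_left
          cinner_scaleC_left c_def)
    then have "cinner (T u) x = complex_of_real s"
      by (simp add: s_def cnj_mult_self del: of_real_power)
    then have "s \<le> norm (T u) * norm x"
      using norm_cinner_le [of "T u" x] by simp
    also have "\<dots> \<le> norm T * norm u * norm x"
      by (intro mult_right_mono norm_blinfun) auto
    finally have "norm u * norm u \<le> norm u * (norm T * norm x)"
      by (simp add: u [symmetric] power2_eq_square mult_ac)
    then have "norm u \<le> norm T * norm x"
      by (cases "norm u = 0") (auto simp: mult_le_cancel_left)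
    then show "(\<Sum>e\<in>F. (cmod (cinner (T e) x))\<^sup>2) \<le> (norm T * norm x)\<^sup>2"
      using u unfolding s_def c_def by (metis norm_ge_zero power_mono)
  qed (simp_all add: cinner_add_right cinner_scaleC_right)
  then obtain S where S: "S \<in> bounded_ops" "\<And>x e. e \<in> E \<Longrightarrow> cinner e (S x) = cinner (T e) x"
    by blast
  have "cinner (S x) y = cinner x (T y)" for x y
  proof (rule onb_bounded_linear_eqI [OF E bounded_linear_cinner_right])
    show "bounded_linear (\<lambda>y. cinner x (T y))"
      by (rule bounded_linear_compose [OF bounded_linear_cinner_right blinfun.bounded_linear_right])
    show "cinner (S x) (c *\<^sub>C e) = cinner x (T (c *\<^sub>C e))" if "e \<in> E" for c e
      using S(2) [OF that, of x] cinner_commute [of "S x" e] cinner_commute [of x "T e"]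
      by (simp add: bounded_ops_scaleC [OF T] cinner_scaleC_right)
  qed
  with S(1) show ?thesis by blast
qed

lemma cinner_ext: "(\<And>y. cinner x y = cinner x' (y::'a::complex_inner)) \<Longrightarrow> x = x'"
  by (metis Re_cinner inner_commute vector_eq_rdot)

lemma adj:
  assumes "T \<in> bounded_ops"
  shows "adj T \<in> bounded_ops" "cinner (adj T x) y = cinner x (T y)"
proof -
  have "\<exists>!S. S \<in> bounded_ops \<and> (\<forall>x y. cinner (S x) y = cinner x (T y))"
  proof (rule ex_ex1I)
    fix S S' assume S: "S \<in> bounded_ops \<and> (\<forall>x y. cinner (S x) y = cinner x (T y))"
      and S': "S' \<in> bounded_ops \<and> (\<forall>x y. cinner (S' x) y = cinner x (T y))"
    show "S = S'"
      by (intro blinfun_eqI cinner_ext) (simp add: S S')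
  qed (use adj_exists [OF assms] in blast)
  from theI' [OF this] show "adj T \<in> bounded_ops" "cinner (adj T x) y = cinner x (T y)"
    by (auto simp: adj_def)
qed

lemma cinner_adj_right:
  assumes "T \<in> bounded_ops"
  shows "cinner x (adj T y) = cinner (T x) y"
  by (metis adj(2) [OF assms] cinner_commute)

lemma bounded_ops_compose: "S \<in> bounded_ops \<Longrightarrow> T \<in> bounded_ops \<Longrightarrow> S o\<^sub>L T \<in> bounded_ops"
  by (simp add: bounded_ops_def)

lemma inner_adj_compose:
  assumes "T \<in> bounded_ops"
  shows "inner x ((adj T o\<^sub>L T) x) = (norm (T x))\<^sup>2"
  by (simp add: cinner_adj_right [OF assms] power2_norm_eq_inner flip: Re_cinner)

lemma positive_operator_adj_compose:
  assumes "T \<in> bounded_ops"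
  shows "positive_operator (adj T o\<^sub>L T)"
  by (simp add: positive_operator_def bounded_ops_compose adj assms cinner_adj_right cinner_self
      del: of_real_power)

lemma compact_operator_adj_compose:
  "compact_operator T \<Longrightarrow> compact_operator (adj T o\<^sub>L T)"
  by (intro compact_operator_compose_left adj compact_operator_bounded)

lemma eigen_onbD:
  assumes "eigen_onb T E"
  shows "is_onb E" "e \<in> E \<Longrightarrow> T e = inner e (T e) *\<^sub>R e"
proof -
  show E: "is_onb E"
    using assms by (simp add: eigen_onb_def)
  show "T e = inner e (T e) *\<^sub>R e" if e: "e \<in> E"
  proof -
    obtain l where "T e = l *\<^sub>R e"
      using assms e by (auto simp: eigen_onb_def)
    moreover have "inner e e = 1"
      using orthonormal_norm [OF is_onb_orthonormal [OF E] e] by (simp add: norm_eq_1)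
    ultimately show ?thesis by simp
  qed
qed

section \<open>Operators diagonal in an orthonormal basis\<close>

lemma onb_diagonal_eqI:
  fixes S T :: "'a::chilbert_space \<Rightarrow>\<^sub>L 'a"
  assumes "is_onb E" "S \<in> bounded_ops" "T \<in> bounded_ops" "\<And>e. e \<in> E \<Longrightarrow> S e = T e"
  shows "S = T"
proof (rule blinfun_eqI)
  show "S x = T x" for x
    by (rule onb_bounded_linear_eqI [OF assms(1) blinfun.bounded_linear_right blinfun.bounded_linear_right])
      (simp add: bounded_ops_scaleC assms)
qed

lemma diagonal_cinner:
  fixes S :: "'a::chilbert_space \<Rightarrow>\<^sub>L 'a"
  assumes E: "is_onb E" and S: "S \<in> bounded_ops" and eig: "\<And>e. e \<in> E \<Longrightarrow> S e = g e *\<^sub>R e" and e: "e \<in> E"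
  shows "cinner e (S x) = of_real (g e) * cinner e x"
proof (rule onb_bounded_linear_eqI [OF E])
  show "bounded_linear (\<lambda>x. cinner e (S x))"
    by (rule bounded_linear_compose [OF bounded_linear_cinner_right blinfun.bounded_linear_right])
  show "bounded_linear (\<lambda>x. of_real (g e) * cinner e x)"
    by (rule bounded_linear_const_mult [OF bounded_linear_cinner_right])
  show "cinner e (S (c *\<^sub>C f)) = of_real (g e) * cinner e (c *\<^sub>C f)" if "f \<in> E" for c f
    using orthonormalD [OF is_onb_orthonormal [OF E] e that]
    by (simp add: bounded_ops_scaleC [OF S] eig [OF that] cinner_scaleC_right cinner_scaleR_right)
qed

text \<open>Kept complex-valued: the real part yields the formula in \<open>diagonal_inner\<close>,
  the imaginary part shows in \<open>diagonal_positive\<close> that the form is real.\<close>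

lemma diagonal_quadratic_form:
  fixes S :: "'a::chilbert_space \<Rightarrow>\<^sub>L 'a"
  assumes E: "is_onb E" and S: "S \<in> bounded_ops" and eig: "\<And>e. e \<in> E \<Longrightarrow> S e = g e *\<^sub>R e"
  shows "((\<lambda>e. complex_of_real (g e * (cmod (cinner e x))\<^sup>2)) has_sum cinner x (S x)) E"
proof -
  have "((\<lambda>e. cinner x (S (cinner e x *\<^sub>C e))) has_sum cinner x (S x)) E"
    by (rule has_sum_bounded_linear [OF bounded_linear_compose [OF bounded_linear_cinner_right
          blinfun.bounded_linear_right] onb_expansion [OF E]])
  moreover have "cinner x (S (cinner e x *\<^sub>C e)) = complex_of_real (g e * (cmod (cinner e x))\<^sup>2)"
    if "e \<in> E" for e
  proof -
    have "cinner x (S (cinner e x *\<^sub>C e)) = of_real (g e) * (cnj (cinner e x) * cinner e x)"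
      by (simp add: bounded_ops_scaleC [OF S] eig [OF that] cinner_scaleC_right cinner_scaleR_right
          flip: cinner_commute [of x e])
    then show ?thesis
      by (simp only: cnj_mult_self of_real_mult)
  qed
  ultimately show ?thesis
    using has_sum_cong [of E "\<lambda>e. cinner x (S (cinner e x *\<^sub>C e))"] by (metis (mono_tags, lifting))
qed

lemma diagonal_inner:
  fixes S :: "'a::chilbert_space \<Rightarrow>\<^sub>L 'a"
  assumes "is_onb E" "S \<in> bounded_ops" "\<And>e. e \<in> E \<Longrightarrow> S e = g e *\<^sub>R e"
  shows "((\<lambda>e. g e * (cmod (cinner e x))\<^sup>2) has_sum inner x (S x)) E"
  using has_sum_Re [OF diagonal_quadratic_form [OF assms]] by (simp add: Re_cinner)

lemma diagonal_positive:
  fixes S :: "'a::chilbert_space \<Rightarrow>\<^sub>L 'a"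
  assumes "is_onb E" "S \<in> bounded_ops" "\<And>e. e \<in> E \<Longrightarrow> S e = g e *\<^sub>R e" "\<And>e. e \<in> E \<Longrightarrow> g e \<ge> 0"
  shows "positive_operator S"
  unfolding positive_operator_def
proof (intro conjI allI)
  fix x
  have "0 \<le> inner x (S x)"
    using diagonal_inner [OF assms(1-3)] by (rule has_sum_nonneg) (auto intro: mult_nonneg_nonneg assms(4))
  moreover have "((\<lambda>_. 0) has_sum Im (cinner x (S x))) E"
    using has_sum_Im [OF diagonal_quadratic_form [OF assms(1-3), of x]] by (simp only: Im_complex_of_real)
  then have "Im (cinner x (S x)) = 0"
    by (rule has_sum_unique [OF _ has_sum_0_simp])
  ultimately show "cinner x (S x) \<in> \<real>\<^sub>\<ge>\<^sub>0"
    by (simp add: complex_nonneg_Reals_iff Re_cinner)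
qed (rule assms)

lemma diagonal_op_exists:
  fixes E :: "'a::chilbert_space set"
  assumes E: "is_onb E" and g: "\<And>e. e \<in> E \<Longrightarrow> \<bar>g e\<bar> \<le> K" and K: "K \<ge> 0"
  shows "\<exists>S\<in>bounded_ops. \<forall>e\<in>E. S e = g e *\<^sub>R e"
proof -
  have "\<exists>S\<in>bounded_ops. \<forall>x. \<forall>e\<in>E. cinner e (S x) = of_real (g e) * cinner e x"
  proof (rule bounded_op_of_coefficients [OF E _ _ _ K])
    fix F x assume F: "finite F" "F \<subseteq> E"
    have "(\<Sum>e\<in>F. (cmod (of_real (g e) * cinner e x))\<^sup>2) \<le> (\<Sum>e\<in>F. K\<^sup>2 * (cmod (cinner e x))\<^sup>2)"
    proof (rule sum_mono)
      fix e assume "e \<in> F"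
      then have "\<bar>g e\<bar> \<le> K"
        using g F by blast
      then show "(cmod (of_real (g e) * cinner e x))\<^sup>2 \<le> K\<^sup>2 * (cmod (cinner e x))\<^sup>2"
        unfolding norm_mult power_mult_distrib norm_of_real
        by (intro mult_right_mono power_mono) auto
    qed
    also have "\<dots> \<le> K\<^sup>2 * (norm x)\<^sup>2"
      unfolding sum_distrib_left [symmetric]
      by (intro mult_left_mono bessel [OF is_onb_orthonormal [OF E] F]) auto
    finally show "(\<Sum>e\<in>F. (cmod (of_real (g e) * cinner e x))\<^sup>2) \<le> (K * norm x)\<^sup>2"
      by (simp add: power_mult_distrib)
  qed (simp_all add: cinner_add_right cinner_scaleC_right algebra_simps)
  then obtain S where S: "S \<in> bounded_ops" "\<And>x e. e \<in> E \<Longrightarrow> cinner e (S x) = of_real (g e) * cinner e x"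
    by blast
  have "S e = g e *\<^sub>R e" if "e \<in> E" for e
  proof (rule onb_eqI [OF E])
    show "cinner f (S e) = cinner f (g e *\<^sub>R e)" if "f \<in> E" for f
      using orthonormalD [OF is_onb_orthonormal [OF E] that \<open>e \<in> E\<close>] S(2) [OF that]
      by (auto simp: cinner_scaleR_right)
  qed
  with S(1) show ?thesis by blast
qed

lemma inner_unit_le_norm:
  fixes T :: "'a::real_inner \<Rightarrow>\<^sub>L 'a"
  assumes "norm e = 1"
  shows "inner e (T e) \<le> norm T"
  using norm_cauchy_schwarz [of e "T e"] norm_blinfun [of T e] assms by simp

text \<open>This resolves the description in \<open>abs_op\<close>. The eigenvalue of
  \<open>adj T o\<^sub>L T\<close> at \<open>e\<close> is \<open>(norm (T e))\<^sup>2\<close>, so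
  the diagonal operator with entries \<open>norm (T e)\<close> is a positive root; any other one is
  forced to agree with it on \<open>E\<close> by
  \<open>positive_operator_square_eigen\<close>.\<close>

lemma abs_op_eigen:
  fixes T :: "'a::chilbert_space \<Rightarrow>\<^sub>L 'a"
  assumes T: "T \<in> bounded_ops" and E: "eigen_onb (adj T o\<^sub>L T) E"
  shows "positive_operator (abs_op T)" "e \<in> E \<Longrightarrow> abs_op T e = norm (T e) *\<^sub>R e"
proof -
  note onb = eigen_onbD(1) [OF E]
  have unit: "norm e = 1" if "e \<in> E" for e
    using orthonormal_norm [OF is_onb_orthonormal [OF onb] that] .
  have eig: "(adj T o\<^sub>L T) e = (norm (T e))\<^sup>2 *\<^sub>R e" if "e \<in> E" for e
    using eigen_onbD(2) [OF E that] inner_adj_compose [OF T, of e] by metis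
  have "\<bar>norm (T e)\<bar> \<le> norm T" if "e \<in> E" for e
    using norm_blinfun [of T e] unit [OF that] by simp
  from diagonal_op_exists [where g = "\<lambda>e. norm (T e)", OF onb this norm_ge_zero]
  obtain P where P: "P \<in> bounded_ops" "\<And>e. e \<in> E \<Longrightarrow> P e = norm (T e) *\<^sub>R e"
    by blast
  have "positive_operator P"
    using P by (intro diagonal_positive [OF onb]) auto
  moreover have "P o\<^sub>L P = adj T o\<^sub>L T"
  proof (rule onb_diagonal_eqI [OF onb])
    show "(P o\<^sub>L P) e = (adj T o\<^sub>L T) e" if "e \<in> E" for e
      using eig [OF that] P(2) [OF that] by (simp add: blinfun.scaleR_right power2_eq_square)
  qed (auto intro: bounded_ops_compose P adj T)
  moreover have "Q = P" if Q: "positive_operator Q" "Q o\<^sub>L Q = adj T o\<^sub>L T" for Q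
  proof (rule onb_diagonal_eqI [OF onb])
    show "Q \<in> bounded_ops"
      using Q(1) by (simp add: positive_operator_def)
    show "Q e = P e" if "e \<in> E" for e
    proof -
      have "Q (Q e) = (norm (T e))\<^sup>2 *\<^sub>R e"
        using eig [OF that] Q(2) by (metis blinfun_apply_blinfun_compose)
      from positive_operator_square_eigen [OF Q(1) this norm_ge_zero] P(2) [OF that]
      show ?thesis
        by metis
    qed
  qed (rule P(1))
  ultimately have "abs_op T = P"
    unfolding abs_op_def by (intro the_equality conjI) blast+
  with \<open>positive_operator P\<close> P(2)
  show "positive_operator (abs_op T)" "e \<in> E \<Longrightarrow> abs_op T e = norm (T e) *\<^sub>R e"
    by auto
qed

text \<open>An eigenvector of \<open>P\<close> for \<open>l\<close> has nonzero coefficients only at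
  those \<open>e\<close> with \<open>g e = l\<close>. Hence the diagonal operator with entries
  \<open>g e powr p\<close> acts correctly on all eigenvectors, and its values on \<open>E\<close>
  determine it.\<close>

lemma powr_op_diagonal:
  fixes P :: "'a::chilbert_space \<Rightarrow>\<^sub>L 'a"
  assumes E: "is_onb E" and P: "P \<in> bounded_ops" and eig: "\<And>e. e \<in> E \<Longrightarrow> P e = g e *\<^sub>R e"
    and g: "\<And>e. e \<in> E \<Longrightarrow> 0 \<le> g e \<and> g e \<le> K" and p: "p > 0"
  shows "powr_op P p \<in> bounded_ops" "e \<in> E \<Longrightarrow> powr_op P p e = (g e powr p) *\<^sub>R e"
proof -
  have "\<bar>g e powr p\<bar> \<le> \<bar>K\<bar> powr p" if "e \<in> E" for e
    using g [OF that] p by (auto intro!: powr_mono2)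
  from diagonal_op_exists [where g = "\<lambda>e. g e powr p", OF E this powr_ge_zero]
  obtain S where S: "S \<in> bounded_ops" "\<And>e. e \<in> E \<Longrightarrow> S e = (g e powr p) *\<^sub>R e"
    by blast
  have S_eig: "S v = (l powr p) *\<^sub>R v" if v: "P v = l *\<^sub>R v" for l v
  proof (rule onb_eqI [OF E])
    fix e assume e: "e \<in> E"
    have "complex_of_real (g e) * cinner e v = of_real l * cinner e v"
      using diagonal_cinner [OF E P eig e, of v] unfolding v cinner_scaleR_right by auto
    then consider "cinner e v = 0" | "g e = l"
      by auto
    then show "cinner e (S v) = cinner e ((l powr p) *\<^sub>R v)"
      using diagonal_cinner [OF E S(1) S(2) e, of v] by cases (simp_all add: cinner_scaleR_right)
  qed
  have "powr_op P p = S"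
    unfolding powr_op_def
  proof (rule the_equality)
    fix S' assume S': "S' \<in> bounded_ops \<and> (\<forall>l v. P v = l *\<^sub>R v \<longrightarrow> S' v = (l powr p) *\<^sub>R v)"
    show "S' = S"
      by (rule onb_diagonal_eqI [OF E]) (use S' S eig in auto)
  qed (use S(1) S_eig in blast)
  with S show "powr_op P p \<in> bounded_ops" "e \<in> E \<Longrightarrow> powr_op P p e = (g e powr p) *\<^sub>R e"
    by auto
qed

text \<open>The trace refers to an unknown basis \<open>B\<close>. Expanding
  \<open>inner b (S b)\<close> over \<open>E\<close>, exchanging the nonnegative sums and applying
  Parseval in \<open>B\<close> removes it.\<close>

lemma trace_pos_diagonal:
  fixes S :: "'a::chilbert_space \<Rightarrow>\<^sub>L 'a"
  assumes E: "is_onb E" and S: "S \<in> bounded_ops" and eig: "\<And>e. e \<in> E \<Longrightarrow> S e = g e *\<^sub>R e"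
    and g: "\<And>e. e \<in> E \<Longrightarrow> g e \<ge> 0"
  shows "trace_pos S = (\<Sum>\<^sub>\<infinity>e\<in>E. ennreal (g e))"
proof -
  define B where "B = (SOME B :: 'a set. is_onb B)"
  have B: "is_onb B"
    unfolding B_def using onb_exists by (rule someI_ex)
  have "trace_pos S = (\<Sum>\<^sub>\<infinity>b\<in>B. ennreal (inner b (S b)))"
    by (simp add: trace_pos_def B_def Re_cinner)
  also have "\<dots> = (\<Sum>\<^sub>\<infinity>b\<in>B. \<Sum>\<^sub>\<infinity>e\<in>E. ennreal (g e * (cmod (cinner e b))\<^sup>2))"
    by (intro infsum_cong has_sum_infsum_ennreal [symmetric] diagonal_inner [OF E S eig]) (simp_all add: g)
  also have "\<dots> = (\<Sum>\<^sub>\<infinity>e\<in>E. \<Sum>\<^sub>\<infinity>b\<in>B. ennreal (g e * (cmod (cinner e b))\<^sup>2))"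
    by (rule infsum_swap_ennreal)
  also have "\<dots> = (\<Sum>\<^sub>\<infinity>e\<in>E. ennreal (g e))"
  proof (rule infsum_cong)
    fix e assume e: "e \<in> E"
    have "((\<lambda>b. g e * (cmod (cinner b e))\<^sup>2) has_sum (g e * (norm e)\<^sup>2)) B"
      by (intro has_sum_cmult_right parseval [OF B])
    then have "(\<Sum>\<^sub>\<infinity>b\<in>B. ennreal (g e * (cmod (cinner b e))\<^sup>2)) = ennreal (g e * (norm e)\<^sup>2)"
      by (rule has_sum_infsum_ennreal) (simp add: g [OF e])
    then show "(\<Sum>\<^sub>\<infinity>b\<in>B. ennreal (g e * (cmod (cinner e b))\<^sup>2)) = ennreal (g e)"
      by (simp add: cmod_cinner_commute [of e] orthonormal_norm [OF is_onb_orthonormal [OF E] e])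
  qed
  finally show ?thesis .
qed

text \<open>For a positive \<open>T\<close> with eigenbasis \<open>E\<close> this is the trace of
  the \<open>q\<close>-th power of \<open>T\<close>, with values in \<open>[0,\<infinity>]\<close>
  so that finiteness can be derived later.\<close>

definition trace_powr :: "real \<Rightarrow> ('a::chilbert_space \<Rightarrow>\<^sub>L 'a) \<Rightarrow> 'a set \<Rightarrow> ennreal" where
  "trace_powr q T E = (\<Sum>\<^sub>\<infinity>e\<in>E. ennreal (inner e (T e) powr q))"

text \<open>The exponent is halved here because the eigenvalues of \<open>adj T o\<^sub>L T\<close>
  are the squares of those of \<open>abs_op T\<close>.\<close>

lemma trace_pos_powr_abs_op:
  fixes T :: "'a::chilbert_space \<Rightarrow>\<^sub>L 'a"
  assumes T: "T \<in> bounded_ops" and E: "eigen_onb (adj T o\<^sub>L T) E" and p: "p > 0"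
  shows "trace_pos (powr_op (abs_op T) p) = trace_powr (p / 2) (adj T o\<^sub>L T) E"
proof -
  note onb = eigen_onbD(1) [OF E]
  have P: "abs_op T \<in> bounded_ops"
    using abs_op_eigen(1) [OF T E] by (simp add: positive_operator_def)
  have g: "0 \<le> norm (T e) \<and> norm (T e) \<le> norm T" if "e \<in> E" for e
    using norm_blinfun [of T e] orthonormal_norm [OF is_onb_orthonormal [OF onb] that] by simp
  note pow = powr_op_diagonal [OF onb P abs_op_eigen(2) [OF T E] g p]
  have "trace_pos (powr_op (abs_op T) p) = (\<Sum>\<^sub>\<infinity>e\<in>E. ennreal (norm (T e) powr p))"
    by (rule trace_pos_diagonal [OF onb pow(1) pow(2)]) auto
  also have "\<dots> = trace_powr (p / 2) (adj T o\<^sub>L T) E"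
    unfolding trace_powr_def inner_adj_compose [OF T]
    by (simp add: powr_powr flip: powr_numeral)
  finally show ?thesis .
qed

subsection \<open>Trace inequalities\<close>

lemma bernoulli_powr_le:
  fixes u q :: real
  assumes "u \<ge> 0" "0 < q" "q \<le> 1"
  shows "u powr q \<le> 1 + q * (u - 1)"
proof (cases "u = 0")
  case False
  \<comment> \<open>Weighted arithmetic-geometric mean of \<open>u\<close> and 1 with weights
    \<open>q\<close> and \<open>1 - q\<close>.\<close>
  then show ?thesis
    using Youngs_inequality_0 [of q "1 - q" u 1] assms by (simp add: algebra_simps)
qed (use assms in simp)

text \<open>The concave case at the point \<open>u powr q\<close> with exponent
  \<open>1 / q\<close>, solved for \<open>u powr q\<close>.\<close>

lemma bernoulli_powr_ge:
  fixes u q :: real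
  assumes "u \<ge> 0" "1 \<le> q"
  shows "1 + q * (u - 1) \<le> u powr q"
  using bernoulli_powr_le [of "u powr q" "1 / q"] assms by (simp add: powr_powr field_simps)

text \<open>
  \<open>powr_le q a b\<close> is the inequality that convexity of \<open>x \<mapsto> x\<^sup>q\<close> yields for \<open>q \<ge> 1\<close>, and the
  reverse one, from concavity, for \<open>q \<le> 1\<close>.
\<close>

definition powr_le :: "real \<Rightarrow> 'b::order \<Rightarrow> 'b \<Rightarrow> bool" where
  "powr_le q a b \<longleftrightarrow> (1 \<le> q \<longrightarrow> a \<le> b) \<and> (q \<le> 1 \<longrightarrow> b \<le> a)"

lemma powr_le_refl [simp]: "powr_le q a a"
  by (simp add: powr_le_def)

lemma powr_le_trans [trans]: "powr_le q a b \<Longrightarrow> powr_le q b c \<Longrightarrow> powr_le q a c"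
  by (meson powr_le_def order.trans)

lemma powr_le_infsum:
  fixes f g :: "'i \<Rightarrow> ennreal"
  shows "(\<And>x. x \<in> A \<Longrightarrow> powr_le q (f x) (g x)) \<Longrightarrow> powr_le q (infsum f A) (infsum g A)"
  by (auto simp: powr_le_def intro!: infsum_mono_ennreal)

lemma powr_le_sum:
  fixes f g :: "'i \<Rightarrow> ennreal"
  shows "(\<And>x. x \<in> A \<Longrightarrow> powr_le q (f x) (g x)) \<Longrightarrow> powr_le q (sum f A) (sum g A)"
  by (auto simp: powr_le_def intro!: sum_mono)

lemma powr_le_mult_left:
  fixes a b c :: ennreal
  shows "powr_le q a b \<Longrightarrow> powr_le q (c * a) (c * b)"
  by (auto simp: powr_le_def intro!: mult_left_mono)

lemma powr_le_ennreal: "powr_le q a b \<Longrightarrow> powr_le q (ennreal a) (ennreal b)"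
  by (auto simp: powr_le_def intro!: ennreal_leI)

text \<open>The left side is the tangent at \<open>t\<close>; the claim is Bernoulli at
  \<open>z / t\<close>, scaled by \<open>t powr q\<close>.\<close>

lemma powr_tangent:
  fixes z t q :: real
  assumes "z \<ge> 0" "t > 0" "q > 0"
  shows "powr_le q (t powr q * (1 + q * (z / t - 1))) (z powr q)"
proof -
  have "z powr q = t powr q * (z / t) powr q"
    using assms by (simp add: powr_divide)
  then show ?thesis
    using assms bernoulli_powr_le [of "z / t" q] bernoulli_powr_ge [of "z / t" q]
    by (auto simp: powr_le_def intro!: mult_left_mono)
qed

text \<open>Sum the tangent at the weighted mean \<open>t\<close> against the weights. A total
  weight \<open>W\<close> below 1 is harmless: it is as if the missing mass sat at the point 0,
  where the power vanishes. \<open>sum_trace_powr_le\<close> relies on this.\<close>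

lemma jensen_powr_has_sum:
  fixes w z :: "'i \<Rightarrow> real"
  assumes w: "(w has_sum W) I" "W \<le> 1" "\<And>i. i \<in> I \<Longrightarrow> w i \<ge> 0"
    and z: "\<And>i. i \<in> I \<Longrightarrow> z i \<ge> 0"
    and t: "((\<lambda>i. w i * z i) has_sum t) I"
    and s: "((\<lambda>i. w i * z i powr q) has_sum s) I"
    and q: "q > 0"
  shows "powr_le q (t powr q) s"
proof -
  have "t \<ge> 0"
    using t by (rule has_sum_nonneg) (simp add: w z)
  show ?thesis
  proof (cases "t = 0")
    case True
    \<comment> \<open>There is no tangent to use at 0, but a vanishing mean of nonnegative terms
      makes every term vanish.\<close>
    have "w i * z i = 0" if "i \<in> I" for i
      using nonneg_has_sum_le_0D [OF t, of i] True that w z by simp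
    then have "w i * z i powr q = 0" if "i \<in> I" for i
      using that by fastforce
    then have "((\<lambda>i. 0) has_sum s) I"
      using s has_sum_cong [of I "\<lambda>i. w i * z i powr q" "\<lambda>_. 0"] by blast
    then have "s = 0"
      by (rule has_sum_unique [OF _ has_sum_0_simp])
    then show ?thesis
      using True by simp
  next
    case False
    then have "t > 0" using \<open>t \<ge> 0\<close> by simp
    define c where "c = t powr q"
    \<comment> \<open>\<open>l\<close> is the weighted sum of the tangent values, computed from the
      total mass \<open>W\<close> and the mean \<open>t\<close>.\<close>
    define l where "l = c * ((1 - q) * W + q)"
    have "((\<lambda>i. c * ((1 - q) * w i + q / t * (w i * z i))) has_sum c * ((1 - q) * W + q / t * t)) I"
      by (intro has_sum_cmult_right has_sum_add w t)
    moreover have "(\<lambda>i. c * ((1 - q) * w i + q / t * (w i * z i))) =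
        (\<lambda>i. w i * (c * (1 + q * (z i / t - 1))))"
      by (simp add: fun_eq_iff algebra_simps)
    ultimately have l: "((\<lambda>i. w i * (c * (1 + q * (z i / t - 1)))) has_sum l) I"
      using \<open>t > 0\<close> unfolding l_def by (metis nonzero_divide_eq_eq order_less_irrefl)
    have tan: "powr_le q (c * (1 + q * (z i / t - 1))) (z i powr q)" if "i \<in> I" for i
      unfolding c_def by (rule powr_tangent) (use z that \<open>t > 0\<close> q in auto)
    have "powr_le q l s"
      unfolding powr_le_def
    proof (intro conjI impI)
      show "l \<le> s" if "1 \<le> q"
        using tan that w(3) by (intro has_sum_mono [OF l s] mult_left_mono) (auto simp: powr_le_def)
      show "s \<le> l" if "q \<le> 1"
        using tan that w(3) by (intro has_sum_mono [OF s l] mult_left_mono) (auto simp: powr_le_def)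
    qed
    moreover have "powr_le q (t powr q) l"
    proof -
      \<comment> \<open>The defect of \<open>l\<close> from \<open>c\<close> is
        \<open>c * (1 - q) * (1 - W)\<close>; its sign switches at \<open>q = 1\<close> exactly as
        the direction of \<open>powr_le\<close> does.\<close>
      have "(1 - q) * (1 - W) \<ge> 0" if "q \<le> 1"
        using that w(2) by (intro mult_nonneg_nonneg) auto
      moreover have "(1 - q) * (1 - W) \<le> 0" if "1 \<le> q"
        using that w(2) by (intro mult_nonpos_nonneg) auto
      moreover have "l = c * (1 - (1 - q) * (1 - W))"
        by (simp add: l_def algebra_simps)
      moreover have "c > 0"
        using \<open>t > 0\<close> by (simp add: c_def)
      ultimately show ?thesis
        by (auto simp: powr_le_def c_def [symmetric] mult_le_cancel_left1 mult_le_cancel_left2)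
    qed
    ultimately show ?thesis
      using powr_le_trans by blast
  qed
qed

text \<open>The uniform bound \<open>M\<close> makes the weighted powers summable, so the real
  inequality carries over to \<open>[0,\<infinity>]\<close>.\<close>

lemma jensen_powr_infsum:
  fixes w z :: "'i \<Rightarrow> real"
  assumes w: "(w has_sum W) I" "W \<le> 1" "\<And>i. i \<in> I \<Longrightarrow> w i \<ge> 0"
    and z: "\<And>i. i \<in> I \<Longrightarrow> 0 \<le> z i \<and> z i \<le> M"
    and t: "((\<lambda>i. w i * z i) has_sum t) I"
    and q: "q > 0"
  shows "powr_le q (ennreal (t powr q)) (\<Sum>\<^sub>\<infinity>i\<in>I. ennreal (w i * z i powr q))"
proof -
  have "(\<lambda>i. w i * z i powr q) summable_on I"
  proof (rule summable_on_comparison_test)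
    show "(\<lambda>i. w i * \<bar>M\<bar> powr q) summable_on I"
      using w(1) by (intro summable_on_cmult_left) (auto simp: summable_on_def)
    show "w i * z i powr q \<le> w i * \<bar>M\<bar> powr q" if "i \<in> I" for i
      using z [OF that] w(3) [OF that] q by (intro mult_left_mono powr_mono2) auto
  qed (simp add: w)
  then have s: "((\<lambda>i. w i * z i powr q) has_sum (\<Sum>\<^sub>\<infinity>i\<in>I. w i * z i powr q)) I"
    by simp
  have "powr_le q (t powr q) (\<Sum>\<^sub>\<infinity>i\<in>I. w i * z i powr q)"
    by (rule jensen_powr_has_sum [OF w(1,2) _ _ t s q]) (use w z in auto)
  then show ?thesis
    using has_sum_infsum_ennreal [OF s] w(3) by (simp add: powr_le_ennreal)
qed

text \<open>Jensen with equal weights \<open>1 / m\<close>; clearing the denominator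
  \<open>m powr q\<close> leaves the factor \<open>m powr (q - 1)\<close>.\<close>

lemma power_mean:
  fixes a :: "'i \<Rightarrow> real"
  assumes I: "finite I" "I \<noteq> {}" and a: "\<And>i. i \<in> I \<Longrightarrow> a i \<ge> 0" and q: "q > 0"
  shows "powr_le q ((\<Sum>i\<in>I. a i) powr q) (real (card I) powr (q - 1) * (\<Sum>i\<in>I. a i powr q))"
proof -
  define m where "m = real (card I)"
  have m: "m > 0"
    using I by (simp add: m_def card_gt_0_iff)
  have "powr_le q ((\<Sum>i\<in>I. 1 / m * a i) powr q) (\<Sum>i\<in>I. 1 / m * a i powr q)"
    by (rule jensen_powr_has_sum [where w = "\<lambda>_. 1 / m" and W = 1, OF has_sum_finiteI _ _ _ has_sum_finiteI has_sum_finiteI])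
      (use I a q m in \<open>auto simp: m_def\<close>)
  moreover have "(\<Sum>i\<in>I. 1 / m * a i) powr q = (\<Sum>i\<in>I. a i) powr q / m powr q"
    using m a by (simp add: powr_divide sum_nonneg flip: sum_divide_distrib)
  moreover have "(\<Sum>i\<in>I. 1 / m * a i powr q) = (m powr (q - 1) * (\<Sum>i\<in>I. a i powr q)) / m powr q"
    using m by (simp add: powr_diff flip: sum_divide_distrib)
  ultimately show ?thesis
    using m by (auto simp: powr_le_def m_def [symmetric] divide_le_cancel)
qed

section \<open>Traces of powers of sums of positive operators\<close>

lemma eigen_inner:
  assumes "positive_operator X" "eigen_onb X E"
  shows "((\<lambda>e. inner e (X e) * (cmod (cinner e x))\<^sup>2) has_sum inner x (X x)) E"
  using assms by (intro diagonal_inner eigen_onbD) (auto simp: positive_operator_def)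

lemma eigen_bounds:
  assumes "positive_operator X" "eigen_onb X E" "e \<in> E"
  shows "0 \<le> inner e (X e) \<and> inner e (X e) \<le> norm X"
  using assms positive_operator_inner(1)
  by (auto intro!: inner_unit_le_norm orthonormal_norm [of E] is_onb_orthonormal eigen_onbD(1))

text \<open>At each eigenvector \<open>f\<close> of \<open>Z\<close>, the power mean inequality
  splits \<open>inner f (Z f)\<close> into the \<open>inner f (X k f)\<close>. Each of these
  averages the eigenvalues of \<open>X k\<close> with the weights
  \<open>(cmod (cinner e f))\<^sup>2\<close> of total mass 1, so Jensen applies.\<close>

lemma trace_powr_sum_le:
  fixes X :: "'k \<Rightarrow> ('a::chilbert_space \<Rightarrow>\<^sub>L 'a)"
  assumes I: "finite I" "I \<noteq> {}"
    and X: "\<And>k. k \<in> I \<Longrightarrow> positive_operator (X k)" "\<And>k. k \<in> I \<Longrightarrow> eigen_onb (X k) (E k)"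
    and Z: "eigen_onb Z F" "\<And>x. inner x (Z x) = (\<Sum>k\<in>I. inner x (X k x))"
    and q: "q > 0"
  shows "powr_le q (trace_powr q Z F) (ennreal (real (card I) powr (q - 1)) * (\<Sum>k\<in>I. trace_powr q (X k) (E k)))"
proof -
  have F: "is_onb F"
    using Z(1) by (rule eigen_onbD)
  have unit: "norm f = 1" if "f \<in> F" for f
    using orthonormal_norm [OF is_onb_orthonormal [OF F] that] .
  \<comment> \<open>\<open>s k f\<close> is the quadratic form at \<open>f\<close> of the
    \<open>q\<close>-th power of \<open>X k\<close>, written in the eigenbasis of
    \<open>X k\<close>.\<close>
  define s where "s = (\<lambda>k f. \<Sum>\<^sub>\<infinity>e\<in>E k. ennreal ((cmod (cinner e f))\<^sup>2 * inner e (X k e) powr q))"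
  have s_le: "powr_le q (ennreal (inner f (X k f) powr q)) (s k f)" if "k \<in> I" "f \<in> F" for k f
    unfolding s_def
  proof (rule jensen_powr_infsum [where W = 1])
    show "((\<lambda>e. (cmod (cinner e f))\<^sup>2) has_sum 1) (E k)"
      using parseval [OF eigen_onbD(1) [OF X(2) [OF that(1)]], of f] unit [OF that(2)] by simp
    show "((\<lambda>e. (cmod (cinner e f))\<^sup>2 * inner e (X k e)) has_sum inner f (X k f)) (E k)"
      using eigen_inner [OF X(1) X(2), OF that(1) that(1), of f] by (simp add: mult.commute)
    show "0 \<le> inner e (X k e) \<and> inner e (X k e) \<le> norm (X k)" if "e \<in> E k" for e
      using eigen_bounds [OF X(1) X(2) that] \<open>k \<in> I\<close> by blast
  qed (use q in auto)
  \<comment> \<open>Summing over \<open>f\<close> first, Parseval in \<open>F\<close> turns the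
    weights of each \<open>e\<close> into 1.\<close>
  have s_sum: "(\<Sum>\<^sub>\<infinity>f\<in>F. s k f) = trace_powr q (X k) (E k)" if "k \<in> I" for k
  proof -
    have "(\<Sum>\<^sub>\<infinity>f\<in>F. s k f) = (\<Sum>\<^sub>\<infinity>e\<in>E k. \<Sum>\<^sub>\<infinity>f\<in>F. ennreal ((cmod (cinner e f))\<^sup>2 * inner e (X k e) powr q))"
      unfolding s_def by (rule infsum_swap_ennreal)
    also have "\<dots> = trace_powr q (X k) (E k)"
      unfolding trace_powr_def
    proof (rule infsum_cong)
      fix e assume e: "e \<in> E k"
      have "norm e = 1"
        using orthonormal_norm [OF is_onb_orthonormal [OF eigen_onbD(1) [OF X(2) [OF that]]] e] .
      then have "((\<lambda>f. (cmod (cinner e f))\<^sup>2 * inner e (X k e) powr q) has_sum 1 * inner e (X k e) powr q) F"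
        using parseval [OF F, of e] by (intro has_sum_cmult_left) (simp add: cmod_cinner_commute [of e])
      then show "(\<Sum>\<^sub>\<infinity>f\<in>F. ennreal ((cmod (cinner e f))\<^sup>2 * inner e (X k e) powr q)) = ennreal (inner e (X k e) powr q)"
        using has_sum_infsum_ennreal by fastforce
    qed
    finally show ?thesis .
  qed
  have "powr_le q (trace_powr q Z F) (\<Sum>\<^sub>\<infinity>f\<in>F. ennreal (real (card I) powr (q - 1)) * (\<Sum>k\<in>I. s k f))"
    unfolding trace_powr_def
  proof (rule powr_le_infsum)
    fix f assume f: "f \<in> F"
    have "powr_le q (inner f (Z f) powr q) (real (card I) powr (q - 1) * (\<Sum>k\<in>I. inner f (X k f) powr q))"
      unfolding Z(2) using positive_operator_inner(1) [OF X(1)] by (intro power_mean I q) auto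
    then have "powr_le q (ennreal (inner f (Z f) powr q))
        (ennreal (real (card I) powr (q - 1)) * (\<Sum>k\<in>I. ennreal (inner f (X k f) powr q)))"
      using powr_le_ennreal by (fastforce simp: ennreal_mult sum_nonneg)
    also have "powr_le q \<dots> (ennreal (real (card I) powr (q - 1)) * (\<Sum>k\<in>I. s k f))"
      by (intro powr_le_mult_left powr_le_sum s_le f)
    finally show "powr_le q (ennreal (inner f (Z f) powr q))
        (ennreal (real (card I) powr (q - 1)) * (\<Sum>k\<in>I. s k f))" .
  qed
  then show ?thesis
    by (simp add: infsum_cmult_ennreal infsum_sum_ennreal [OF I(1)] s_sum)
qed

text \<open>
  The eigenvalue \<open>x\<close> of a summand \<open>X \<le> Z\<close> is the average of the eigenvalues of \<open>Z\<close> with the weights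
  \<open>|\<langle>f, e\<rangle>|\<^sup>2 x / z\<^sub>f\<close>. Their sum \<open>x \<langle>e, Z\<^sup>-\<^sup>1 e\<rangle>\<close> is at most \<open>1\<close>: test \<open>X \<le> Z\<close> on truncations of
  \<open>Z\<^sup>-\<^sup>1 e\<close>.
\<close>

lemma weight_sum_le_1:
  fixes Z :: "'a::chilbert_space \<Rightarrow>\<^sub>L 'a"
  assumes Z: "positive_operator Z" "eigen_onb Z F"
    and x: "x \<ge> 0" "\<And>u. x * (cmod (cinner e u))\<^sup>2 \<le> inner u (Z u)"
    and K: "finite K" "K \<subseteq> F"
  shows "(\<Sum>f\<in>K. (cmod (cinner f e))\<^sup>2 * x / inner f (Z f)) \<le> 1"
proof -
  define z where "z = (\<lambda>f. inner f (Z f))"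
  define s where "s = (\<Sum>f\<in>K. (cmod (cinner f e))\<^sup>2 / z f)"
  \<comment> \<open>\<open>u\<close> is the inverse of \<open>Z\<close> applied to \<open>e\<close>,
    truncated to \<open>K\<close>. Where \<open>z f = 0\<close>, division by zero sets the
    coefficient to 0.\<close>
  define c where "c = (\<lambda>f. cinner f e / of_real (z f))"
  define u where "u = (\<Sum>f\<in>K. c f *\<^sub>C f)"
  have F: "is_onb F"
    using Z(2) by (rule eigen_onbD)
  have z: "z f \<ge> 0" for f
    unfolding z_def using Z(1) by (rule positive_operator_inner)
  have "cinner e u = of_real s"
  proof -
    have "c f * cinner e f = of_real ((cmod (cinner f e))\<^sup>2 / z f)" for f
      using cnj_mult_self [of "cinner f e"] cinner_commute [of e f]
      by (simp add: c_def mult.commute del: of_real_power)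
    then show ?thesis
      by (simp add: u_def s_def cinner_sum_right cinner_scaleC_right del: of_real_power)
  qed
  moreover have "inner u (Z u) = s"
  proof -
    have cu: "cinner f u = (if f \<in> K then c f else 0)" if "f \<in> F" for f
      unfolding u_def by (rule orthonormal_cinner_sum [OF is_onb_orthonormal [OF F] K that])
    have "z f * (cmod (c f))\<^sup>2 = (cmod (cinner f e))\<^sup>2 / z f" for f
      using z [of f] by (simp add: c_def norm_divide power_divide power2_eq_square)
    then have "s = (\<Sum>f\<in>K. z f * (cmod (cinner f u))\<^sup>2)"
      unfolding s_def by (intro sum.cong) (use cu K in auto)
    moreover have "((\<lambda>f. z f * (cmod (cinner f u))\<^sup>2) has_sum inner u (Z u)) F"
      unfolding z_def by (rule eigen_inner [OF Z])
    moreover have "((\<lambda>f. z f * (cmod (cinner f u))\<^sup>2) has_sum (\<Sum>f\<in>K. z f * (cmod (cinner f u))\<^sup>2)) F"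
      by (rule has_sum_finite_neutralI [OF K(1) K(2)]) (use cu in auto)
    ultimately show ?thesis
      using has_sum_unique by metis
  qed
  \<comment> \<open>Both \<open>cinner e u\<close> and \<open>inner u (Z u)\<close> equal
    \<open>s\<close>, so the hypothesis on \<open>x\<close> at \<open>u\<close> is quadratic in
    \<open>s\<close> on the left and linear on the right.\<close>
  ultimately have "x * s * s \<le> 1 * s"
    using x(2) [of u] by (simp add: power2_eq_square)
  moreover have "s \<ge> 0"
    unfolding s_def by (intro sum_nonneg) (simp add: z)
  ultimately have "x * s \<le> 1"
    by (cases "s = 0") (auto simp: mult_le_cancel_right)
  moreover have "(\<Sum>f\<in>K. (cmod (cinner f e))\<^sup>2 * x / inner f (Z f)) = x * s"
    by (simp add: s_def z_def sum_distrib_left mult.commute)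
  ultimately show ?thesis by simp
qed

text \<open>Now Jensen is applied at each eigenvector of each \<open>X k\<close>, to the eigenvalues
  of \<open>Z\<close>. After exchanging sums, the weights at a fixed \<open>f\<close> add up over
  \<open>k\<close> and \<open>e\<close> to \<open>inner f (Z f) / z f\<close>, which is 1 unless
  \<open>z f = 0\<close>.\<close>

lemma sum_trace_powr_le:
  fixes X :: "'k \<Rightarrow> ('a::chilbert_space \<Rightarrow>\<^sub>L 'a)"
  assumes I: "finite I"
    and X: "\<And>k. k \<in> I \<Longrightarrow> positive_operator (X k)" "\<And>k. k \<in> I \<Longrightarrow> eigen_onb (X k) (E k)"
    and Z: "positive_operator Z" "eigen_onb Z F" "\<And>x. inner x (Z x) = (\<Sum>k\<in>I. inner x (X k x))"
    and q: "q > 0"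
  shows "powr_le q (\<Sum>k\<in>I. trace_powr q (X k) (E k)) (trace_powr q Z F)"
proof -
  have F: "is_onb F"
    using Z(2) by (rule eigen_onbD)
  define z where "z = (\<lambda>f. inner f (Z f))"
  define w where "w = (\<lambda>k e f. (cmod (cinner f e))\<^sup>2 * inner e (X k e) / z f)"
  have z: "z f \<ge> 0" for f
    unfolding z_def using Z(1) by (rule positive_operator_inner)
  \<comment> \<open>\<open>Z\<close> dominates \<open>X k\<close>, which dominates its own spectral
    part along \<open>e\<close>.\<close>
  have dom: "inner e (X k e) * (cmod (cinner e u))\<^sup>2 \<le> inner u (Z u)" if k: "k \<in> I" and e: "e \<in> E k" for k e u
  proof -
    have "(\<Sum>e\<in>{e}. inner e (X k e) * (cmod (cinner e u))\<^sup>2) \<le> inner u (X k u)"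
      using e positive_operator_inner(1) [OF X(1) [OF k]]
      by (intro finite_sum_le_has_sum [OF eigen_inner [OF X(1) X(2), OF k k]]) auto
    also have "\<dots> \<le> (\<Sum>k\<in>I. inner u (X k u))"
      using k positive_operator_inner(1) [OF X(1)] by (intro member_le_sum I) auto
    finally show ?thesis
      by (simp add: Z(3))
  qed
  have le: "powr_le q (ennreal (inner e (X k e) powr q)) (\<Sum>\<^sub>\<infinity>f\<in>F. ennreal (w k e f * z f powr q))"
    if k: "k \<in> I" and e: "e \<in> E k" for k e
  proof -
    define x where "x = inner e (X k e)"
    have x: "x \<ge> 0"
      unfolding x_def using X(1) [OF k] by (rule positive_operator_inner)
    have w_nonneg: "w k e f \<ge> 0" for f
      using x z by (simp add: w_def x_def)
    have w_sum: "(\<Sum>f\<in>K. w k e f) \<le> 1" if "finite K" "K \<subseteq> F" for K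
      unfolding w_def z_def using x dom [OF k e] that
      by (intro weight_sum_le_1 [OF Z(1,2)]) (auto simp: x_def)
    have "w k e summable_on F"
      using w_nonneg w_sum by (intro nonneg_bdd_above_summable_on) (auto simp: bdd_above_def)
    then have W: "(w k e has_sum infsum (w k e) F) F"
      by simp
    show ?thesis
    proof (rule jensen_powr_infsum [OF W])
      show "infsum (w k e) F \<le> 1"
        using W by (rule has_sum_le_finite_sums) (rule w_sum)
      show "0 \<le> z f \<and> z f \<le> norm Z" if "f \<in> F" for f
        using eigen_bounds [OF Z(1,2) that] by (simp add: z_def)
      \<comment> \<open>At \<open>z f = 0\<close> the weight is 0 by division, and the right side
        vanishes too, by \<open>dom\<close> at \<open>u = f\<close>.\<close>
      have "w k e f * z f = (cmod (cinner f e))\<^sup>2 * x" for f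
      proof (cases "z f = 0")
        case True
        then have "x * (cmod (cinner e f))\<^sup>2 \<le> 0"
          using dom [OF k e, of f] by (simp add: x_def z_def)
        moreover have "x * (cmod (cinner e f))\<^sup>2 \<ge> 0"
          using x by simp
        ultimately show ?thesis
          using True by (auto simp: cmod_cinner_commute [of f e])
      qed (simp add: w_def x_def)
      moreover have "norm e = 1"
        using orthonormal_norm [OF is_onb_orthonormal [OF eigen_onbD(1) [OF X(2) [OF k]]] e] .
      then have "((\<lambda>f. (cmod (cinner f e))\<^sup>2 * x) has_sum 1 * x) F"
        using parseval [OF F, of e] by (intro has_sum_cmult_left) simp
      ultimately show "((\<lambda>f. w k e f * z f) has_sum inner e (X k e)) F"
        by (simp add: x_def)
    qed (use q w_nonneg in auto)
  qed
  have "powr_le q (\<Sum>k\<in>I. trace_powr q (X k) (E k))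
      (\<Sum>k\<in>I. \<Sum>\<^sub>\<infinity>e\<in>E k. \<Sum>\<^sub>\<infinity>f\<in>F. ennreal (w k e f * z f powr q))"
    unfolding trace_powr_def by (intro powr_le_sum powr_le_infsum le)
  also have "(\<Sum>k\<in>I. \<Sum>\<^sub>\<infinity>e\<in>E k. \<Sum>\<^sub>\<infinity>f\<in>F. ennreal (w k e f * z f powr q)) =
      (\<Sum>\<^sub>\<infinity>f\<in>F. \<Sum>k\<in>I. \<Sum>\<^sub>\<infinity>e\<in>E k. ennreal (w k e f * z f powr q))"
    by (subst infsum_swap_ennreal) (simp add: infsum_sum_ennreal [OF I])
  also have "\<dots> = trace_powr q Z F"
    unfolding trace_powr_def
  proof (rule infsum_cong)
    fix f assume f: "f \<in> F"
    \<comment> \<open>For \<open>z f = 0\<close> both \<open>a\<close> and \<open>z f powr q\<close>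
      are 0, so \<open>a * z f = z f powr q\<close> holds without a case split.\<close>
    define a where "a = z f powr q / z f"
    have "(\<Sum>\<^sub>\<infinity>e\<in>E k. ennreal (w k e f * z f powr q)) = ennreal (a * inner f (X k f))" if k: "k \<in> I" for k
    proof (rule has_sum_infsum_ennreal)
      have "((\<lambda>e. a * (inner e (X k e) * (cmod (cinner e f))\<^sup>2)) has_sum a * inner f (X k f)) (E k)"
        by (intro has_sum_cmult_right eigen_inner X k)
      moreover have "a * (inner e (X k e) * (cmod (cinner e f))\<^sup>2) = w k e f * z f powr q" for e
        by (simp add: a_def w_def cmod_cinner_commute [of f])
      ultimately show "((\<lambda>e. w k e f * z f powr q) has_sum a * inner f (X k f)) (E k)"
        by simp
      show "0 \<le> w k e f * z f powr q" for e
        using z positive_operator_inner(1) [OF X(1) [OF k]] by (simp add: w_def)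
    qed
    moreover have "a \<ge> 0"
      using z by (simp add: a_def)
    ultimately have "(\<Sum>k\<in>I. \<Sum>\<^sub>\<infinity>e\<in>E k. ennreal (w k e f * z f powr q)) = ennreal (a * z f)"
      using positive_operator_inner(1) [OF X(1)]
      by (simp add: sum_ennreal z_def Z(3) sum_distrib_left)
    also have "a * z f = z f powr q"
      by (simp add: a_def)
    finally show "(\<Sum>k\<in>I. \<Sum>\<^sub>\<infinity>e\<in>E k. ennreal (w k e f * z f powr q)) = ennreal (inner f (Z f) powr q)"
      by (simp add: z_def)
  qed
  finally show ?thesis .
qed

subsection \<open>Sums of Schatten norms\<close>

text \<open>The \<open>p\<close>-th power of the Schatten norm before conversion to a real, hence
  still able to express an infinite value.\<close>

definition schatten_trace :: "real \<Rightarrow> ('a::chilbert_space \<Rightarrow>\<^sub>L 'a) \<Rightarrow> ennreal" where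
  "schatten_trace p T = trace_pos (powr_op (abs_op T) p)"

lemma schatten_norm_powr:
  assumes "p > 0"
  shows "schatten_norm p T powr p = enn2real (schatten_trace p T)"
  using assms by (simp add: schatten_norm_def schatten_trace_def powr_powr)

text \<open>Equal sums of squared norms mean that both families decompose the same \<open>Z\<close>.
  The two trace inequalities, one for each family, are chained through the trace of its
  power.\<close>

lemma sum_schatten_trace_le:
  fixes S :: "'k \<Rightarrow> ('a::chilbert_space \<Rightarrow>\<^sub>L 'a)" and T :: "'l \<Rightarrow> ('a \<Rightarrow>\<^sub>L 'a)"
  assumes I: "finite I" and J: "finite J" "J \<noteq> {}"
    and S: "\<And>k. k \<in> I \<Longrightarrow> compact_operator (S k)"
    and T: "\<And>l. l \<in> J \<Longrightarrow> compact_operator (T l)"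
    and eq: "\<And>x. (\<Sum>k\<in>I. (norm (S k x))\<^sup>2) = (\<Sum>l\<in>J. (norm (T l x))\<^sup>2)"
    and p: "p > 0"
  shows "powr_le (p / 2) (\<Sum>k\<in>I. schatten_trace p (S k))
    (ennreal (real (card J) powr (p / 2 - 1)) * (\<Sum>l\<in>J. schatten_trace p (T l)))"
proof -
  define G where "G = (\<lambda>U :: 'a \<Rightarrow>\<^sub>L 'a. adj U o\<^sub>L U)"
  define E where "E = (\<lambda>U. SOME E. eigen_onb (G U) E)"
  have G: "positive_operator (G U)" "compact_operator (G U)" "inner x (G U x) = (norm (U x))\<^sup>2"
    if "compact_operator U" for U x
    using that positive_operator_adj_compose [of U] compact_operator_adj_compose [of U]
      inner_adj_compose [of U] compact_operator_bounded [of U] by (simp_all add: G_def)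
  have E: "eigen_onb (G U) (E U)" if "compact_operator U" for U
    unfolding E_def using compact_positive_eigen_onb [OF G(1,2), OF that that] by (rule someI_ex)
  have tr: "schatten_trace p U = trace_powr (p / 2) (G U) (E U)" if "compact_operator U" for U
    using trace_pos_powr_abs_op [OF compact_operator_bounded [OF that] _ p] E [OF that]
    by (simp add: schatten_trace_def G_def)
  define Z where "Z = (\<Sum>k\<in>I. G (S k))"
  have Z: "positive_operator Z" "compact_operator Z"
    unfolding Z_def using G S by (auto intro!: positive_operator_sum compact_operator_sum)
  then obtain F where F: "eigen_onb Z F"
    using compact_positive_eigen_onb by blast
  have ZS: "inner x (Z x) = (\<Sum>k\<in>I. inner x (G (S k) x))" for x
    by (simp add: Z_def blinfun.sum_left inner_sum_right)
  have ZT: "inner x (Z x) = (\<Sum>l\<in>J. inner x (G (T l) x))" for x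
    unfolding ZS using eq [of x] by (simp add: G S T)
  have "powr_le (p / 2) (\<Sum>k\<in>I. trace_powr (p / 2) (G (S k)) (E (S k))) (trace_powr (p / 2) Z F)"
    using p by (intro sum_trace_powr_le [OF I _ _ Z(1) F ZS] G E S) auto
  also have "powr_le (p / 2) (trace_powr (p / 2) Z F)
      (ennreal (real (card J) powr (p / 2 - 1)) * (\<Sum>l\<in>J. trace_powr (p / 2) (G (T l)) (E (T l))))"
    using p by (intro trace_powr_sum_le [OF J _ _ F ZT] G E T) auto
  finally show ?thesis
    by (simp add: tr S T)
qed

text \<open>The family \<open>S\<close> is compared with the \<open>A i\<close> and
  \<open>B i\<close>, each repeated \<open>n\<close> times to match the factor \<open>n\<close> in
  \<open>eq\<close>. The comparison is made in both directions: one gives the estimate, and for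
  \<open>p < 2\<close> the other gives finiteness.\<close>

lemma sum_schatten_norm_le:
  fixes S :: "nat \<Rightarrow> nat \<Rightarrow> ('a::chilbert_space \<Rightarrow>\<^sub>L 'a)" and A B :: "nat \<Rightarrow> ('a \<Rightarrow>\<^sub>L 'a)"
  assumes n: "n \<ge> 1" and p: "p > 0"
    and A: "\<And>i. i \<in> {1..n} \<Longrightarrow> A i \<in> schatten_class p"
    and B: "\<And>i. i \<in> {1..n} \<Longrightarrow> B i \<in> schatten_class p"
    and S: "\<And>i j. i \<in> {1..n} \<Longrightarrow> j \<in> {1..n} \<Longrightarrow> compact_operator (S i j)"
    and eq: "\<And>x. (\<Sum>i=1..n. \<Sum>j=1..n. (norm (S i j x))\<^sup>2) =
      real n * ((\<Sum>i=1..n. (norm (A i x))\<^sup>2) + (\<Sum>i=1..n. (norm (B i x))\<^sup>2))"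
  shows "powr_le (p / 2) (\<Sum>i=1..n. \<Sum>j=1..n. schatten_norm p (S i j) powr p)
    (2 powr (p / 2 - 1) * real n powr (p - 1) *
      ((\<Sum>i=1..n. schatten_norm p (A i) powr p) + (\<Sum>i=1..n. schatten_norm p (B i) powr p)))"
proof -
  define N where "N = {1..n} \<times> {1..n}"
  \<comment> \<open>Two copies of the index square: the boolean selects \<open>A i\<close> or
    \<open>B j\<close>, and the other index only produces the \<open>n\<close> repetitions.\<close>
  define J where "J = (UNIV :: bool set) \<times> N"
  define T where "T = (\<lambda>(b, i, j). if b then A i else B j)"
  define c where "c = real (card J) powr (p / 2 - 1)"
  have N: "finite N" "N \<noteq> {}" and J: "finite J" "J \<noteq> {}"
    using n by (auto simp: N_def J_def)
  have sum_J: "(\<Sum>l\<in>J. f (T l)) = of_nat n * ((\<Sum>i=1..n. f (A i)) + (\<Sum>i=1..n. f (B i)))"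
    for f :: "_ \<Rightarrow> 'b::comm_semiring_1"
    by (simp add: J_def N_def T_def UNIV_bool sum.cartesian_product' distrib_left add.commute
        flip: sum_distrib_left)
  have sum_N: "(\<Sum>(i, j)\<in>N. g i j) = (\<Sum>i=1..n. \<Sum>j=1..n. g i j)" for g :: "_ \<Rightarrow> _ \<Rightarrow> 'b::comm_monoid_add"
    by (simp add: N_def sum.cartesian_product)
  have compact_S: "compact_operator ((\<lambda>(i, j). S i j) k)" if "k \<in> N" for k
    using that S by (auto simp: N_def)
  have compact_T: "compact_operator (T l)" if "l \<in> J" for l
    using that A B by (auto simp: J_def N_def T_def schatten_class_def)
  have forms: "(\<Sum>k\<in>N. (norm ((\<lambda>(i, j). S i j) k x))\<^sup>2) = (\<Sum>l\<in>J. (norm (T l x))\<^sup>2)" for x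
    using eq [of x] sum_J [of "\<lambda>U. (norm (U x))\<^sup>2"] sum_N [of "\<lambda>i j. (norm (S i j x))\<^sup>2"]
    by (simp add: split_def)
  define s where "s = (\<Sum>i=1..n. \<Sum>j=1..n. schatten_trace p (S i j))"
  define t where "t = real n * ((\<Sum>i=1..n. schatten_norm p (A i) powr p) + (\<Sum>i=1..n. schatten_norm p (B i) powr p))"
  have sum_s: "(\<Sum>k\<in>N. schatten_trace p ((\<lambda>(i, j). S i j) k)) = s"
    using sum_N [of "\<lambda>i j. schatten_trace p (S i j)"] by (simp add: split_def s_def)
  have fin: "schatten_trace p U = ennreal (schatten_norm p U powr p)" if "U \<in> schatten_class p" for U :: "'a \<Rightarrow>\<^sub>L 'a"
    using that by (simp add: schatten_norm_powr [OF p] schatten_class_def schatten_trace_def less_top)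
  have t_nonneg: "t \<ge> 0"
    by (simp add: t_def sum_nonneg)
  have sum_t: "(\<Sum>l\<in>J. schatten_trace p (T l)) = ennreal t"
    unfolding sum_J using A B
    by (simp add: fin t_def ennreal_mult sum_nonneg ennreal_of_nat_eq_real_of_nat)
  have upper: "powr_le (p / 2) s (ennreal (c * t))"
    using sum_schatten_trace_le [OF N(1) J compact_S compact_T forms p] t_nonneg
    by (simp add: sum_s sum_t c_def ennreal_mult)
  have lower: "powr_le (p / 2) (ennreal t) (ennreal (real (card N) powr (p / 2 - 1)) * s)"
    using sum_schatten_trace_le [OF J(1) N compact_T compact_S forms [symmetric] p]
    by (simp add: sum_s sum_t)
  \<comment> \<open>Without this, \<open>enn2real\<close> could send an infinite trace to 0. For
    \<open>p \<ge> 2\<close> the bound \<open>upper\<close> suffices; otherwise \<open>lower\<close>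
    bounds a positive multiple of \<open>s\<close> by the finite \<open>t\<close>.\<close>
  have "s < top"
  proof (cases "p \<ge> 2")
    case True
    then show ?thesis
      using upper by (auto simp: powr_le_def intro: le_less_trans)
  next
    case False
    then have "ennreal (real (card N) powr (p / 2 - 1)) * s \<le> ennreal t"
      using lower by (auto simp: powr_le_def)
    then have "ennreal (real (card N) powr (p / 2 - 1)) * s < top"
      by (rule le_less_trans) simp
    moreover have "real (card N) powr (p / 2 - 1) > 0"
      using N by (simp add: card_gt_0_iff)
    ultimately show ?thesis
      by (auto simp: ennreal_mult_less_top)
  qed
  then have "schatten_trace p (S i j) < top" if "i \<in> {1..n}" "j \<in> {1..n}" for i j
    using that by (auto simp: s_def ennreal_sum_less_top)
  then have "s = ennreal (\<Sum>i=1..n. \<Sum>j=1..n. schatten_norm p (S i j) powr p)"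
    by (simp add: s_def schatten_norm_powr [OF p] sum_nonneg flip: sum_ennreal)
  with upper t_nonneg have "powr_le (p / 2) (\<Sum>i=1..n. \<Sum>j=1..n. schatten_norm p (S i j) powr p) (c * t)"
    by (simp add: powr_le_def sum_nonneg c_def)
  \<comment> \<open>\<open>J\<close> has \<open>2 * n * n\<close> elements, and the extra factor
    \<open>n\<close> comes from \<open>t\<close>.\<close>
  moreover have "c * real n = 2 powr (p / 2 - 1) * real n powr (p - 1)"
  proof -
    have "c = 2 powr (p / 2 - 1) * (real n powr (p / 2 - 1) * real n powr (p / 2 - 1))"
      by (simp add: c_def J_def N_def card_cartesian_product powr_mult)
    also have "\<dots> * real n = 2 powr (p / 2 - 1) * real n powr ((p / 2 - 1) + (p / 2 - 1) + 1)"
      using n by (simp only: powr_add) simp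
    finally show ?thesis
      by simp
  qed
  ultimately show ?thesis
    by (simp add: t_def flip: mult.assoc)
qed

text \<open>The cross terms add up to \<open>inner x\<close> of the operator sum in
  \<open>orth\<close> applied to \<open>x\<close>, hence to 0 for either sign; every remaining
  square is counted once per value of the other index.\<close>

lemma sum_norm_square_parallelogram:
  fixes A B :: "nat \<Rightarrow> ('a::chilbert_space \<Rightarrow>\<^sub>L 'a)"
  assumes A: "\<And>i. i \<in> {1..n} \<Longrightarrow> A i \<in> bounded_ops"
    and orth: "(\<Sum>i=1..n. \<Sum>j=1..n. adj (A i) o\<^sub>L B j) = 0"
  shows "(\<Sum>i=1..n. \<Sum>j=1..n. (norm ((A i + B j) x))\<^sup>2) =
      real n * ((\<Sum>i=1..n. (norm (A i x))\<^sup>2) + (\<Sum>i=1..n. (norm (B i x))\<^sup>2))" (is ?plus)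
    and "(\<Sum>i=1..n. \<Sum>j=1..n. (norm ((A i - B j) x))\<^sup>2) =
      real n * ((\<Sum>i=1..n. (norm (A i x))\<^sup>2) + (\<Sum>i=1..n. (norm (B i x))\<^sup>2))" (is ?minus)
proof -
  have "(\<Sum>i=1..n. \<Sum>j=1..n. inner (A i x) (B j x)) = (\<Sum>i=1..n. \<Sum>j=1..n. inner x ((adj (A i) o\<^sub>L B j) x))"
    using cinner_adj_right [OF A] by (intro sum.cong refl) (simp flip: Re_cinner)
  also have "\<dots> = inner x ((\<Sum>i=1..n. \<Sum>j=1..n. adj (A i) o\<^sub>L B j) x)"
    by (simp only: blinfun.sum_left inner_sum_right)
  finally have cross: "(\<Sum>i=1..n. \<Sum>j=1..n. inner (A i x) (B j x)) = 0"
    using orth by simp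
  have plus: "(norm ((A i + B j) x))\<^sup>2 = (norm (A i x))\<^sup>2 + (norm (B j x))\<^sup>2 + 2 * inner (A i x) (B j x)" for i j
    by (simp add: plus_blinfun.rep_eq power2_norm_eq_inner inner_add_left inner_add_right inner_commute)
  have minus: "(norm ((A i - B j) x))\<^sup>2 = (norm (A i x))\<^sup>2 + (norm (B j x))\<^sup>2 - 2 * inner (A i x) (B j x)" for i j
    by (simp add: minus_blinfun.rep_eq power2_norm_eq_inner inner_diff_left inner_diff_right inner_commute)
  show ?plus
    unfolding plus using cross
    by (simp add: sum.distrib distrib_left flip: sum_distrib_left)
  show ?minus
    unfolding minus using cross
    by (simp add: sum.distrib sum_subtractf distrib_left flip: sum_distrib_left)
qed

theorem theorem2p2:
  fixes A B :: "nat \<Rightarrow> ('a::chilbert_space \<Rightarrow>\<^sub>L 'a)" and n :: nat and p :: real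
  assumes separable: "\<exists>D :: 'a set. countable D \<and> closure D = UNIV"
    and n: "n \<ge> 1"
    and p: "p > 0"
    and A: "\<And>i. i \<in> {1..n} \<Longrightarrow> A i \<in> schatten_class p"
    and B: "\<And>i. i \<in> {1..n} \<Longrightarrow> B i \<in> schatten_class p"
    and orth: "(\<Sum>i=1..n. \<Sum>j=1..n. adj (A i) o\<^sub>L B j) = 0"
  shows
    "(p \<le> 2 \<longrightarrow>
       2 powr (p / 2 - 1) * real n powr (p - 1) *
         ((\<Sum>i=1..n. schatten_norm p (A i) powr p) + (\<Sum>i=1..n. schatten_norm p (B i) powr p))
         \<le> (\<Sum>i=1..n. \<Sum>j=1..n. schatten_norm p (A i + B j) powr p) \<and>
       2 powr (p / 2 - 1) * real n powr (p - 1) *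
         ((\<Sum>i=1..n. schatten_norm p (A i) powr p) + (\<Sum>i=1..n. schatten_norm p (B i) powr p))
         \<le> (\<Sum>i=1..n. \<Sum>j=1..n. schatten_norm p (A i - B j) powr p)) \<and>
     (2 \<le> p \<longrightarrow>
       (\<Sum>i=1..n. \<Sum>j=1..n. schatten_norm p (A i + B j) powr p)
         \<le> 2 powr (p / 2 - 1) * real n powr (p - 1) *
           ((\<Sum>i=1..n. schatten_norm p (A i) powr p) + (\<Sum>i=1..n. schatten_norm p (B i) powr p)) \<and>
       (\<Sum>i=1..n. \<Sum>j=1..n. schatten_norm p (A i - B j) powr p)
         \<le> 2 powr (p / 2 - 1) * real n powr (p - 1) *
           ((\<Sum>i=1..n. schatten_norm p (A i) powr p) + (\<Sum>i=1..n. schatten_norm p (B i) powr p)))"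
proof -
  have compact: "compact_operator (A i)" "compact_operator (B i)" if "i \<in> {1..n}" for i
    using A [OF that] B [OF that] by (auto simp: schatten_class_def)
  note forms = sum_norm_square_parallelogram [OF compact_operator_bounded [OF compact(1)] orth]
  show ?thesis
    using sum_schatten_norm_le [OF n p A B compact_operator_add [OF compact] forms(1)]
      sum_schatten_norm_le [OF n p A B compact_operator_diff [OF compact] forms(2)]
    by (simp add: powr_le_def)
qed

end
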